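(* Every at most countable distributive $\langle\vee,0\rangle$-semilattice is isomorphic to the $\langle\vee,0\rangle$-semilattice of all finitely generated $\ell$-ideals of some $\ell$-group.
   Context: A $\langle\vee,0\rangle$-semilattice $S$ is distributive if for all $a,b,c\in S$ with $c\leq a\vee b$ there are $a'\leq a$ and $b'\leq b$ in $S$ such that $c=a'\vee b'$. An $\ell$-group is a lattice-ordered group (not necessarily commutative). An $\ell$-ideal of an $\ell$-group $G$ is a convex normal $\ell$-subgroup of $G$ (the kernel of an $\ell$-group homomorphism); the $\ell$-ideals form an algebraic lattice under inclusion, whose compact elements are the finitely generated $\ell$-ideals, which form a $\langle\vee,0\rangle$-semilattice. *)

theory Defs
  imports "HOL-Algebra.Coset" "HOL-Library.Countable_Set"
begin

section \<open>Distributive semilattices with zero\<close>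

text \<open>
  The order of a \<open>\<langle>\<or>,0\<rangle>\<close>-semilattice is the one given by \<open>x \<sqsubseteq> y \<longleftrightarrow> x \<squnion> y = y\<close>; \<open>0\<close> is its
  least element \<open>\<bottom>\<close>.
\<close>

locale semilattice_zero = upper_semilattice L + weak_partial_order_bottom L
  for L (structure)

locale distributive_semilattice_zero = semilattice_zero +
  assumes refinement:
    "\<lbrakk>a \<in> carrier L; b \<in> carrier L; c \<in> carrier L; c \<sqsubseteq> a \<squnion> b\<rbrakk>
      \<Longrightarrow> \<exists>a' \<in> carrier L. \<exists>b' \<in> carrier L. a' \<sqsubseteq> a \<and> b' \<sqsubseteq> b \<and> c = a' \<squnion> b'"

definition semilattice_zero_iso ::
    "('a, 'c) gorder_scheme \<Rightarrow> ('b, 'd) gorder_scheme \<Rightarrow> ('a \<Rightarrow> 'b) set"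
  where "semilattice_zero_iso S T =
    {f. bij_betw f (carrier S) (carrier T) \<and>
        f \<bottom>\<^bsub>S\<^esub> = \<bottom>\<^bsub>T\<^esub> \<and>
        (\<forall>x \<in> carrier S. \<forall>y \<in> carrier S. f (x \<squnion>\<^bsub>S\<^esub> y) = f x \<squnion>\<^bsub>T\<^esub> f y)}"


section \<open>Lattice-ordered groups\<close>

text \<open>
  The group operation is written multiplicatively and is not assumed commutative.
\<close>

record 'a ordered_monoid = "'a monoid" +
  ole :: "'a \<Rightarrow> 'a \<Rightarrow> bool" (infixl \<open>\<preceq>\<index>\<close> 50)

definition order_of :: "('a, 'b) ordered_monoid_scheme \<Rightarrow> 'a gorder"
  where "order_of G = \<lparr>carrier = carrier G, eq = (=), le = ole G\<rparr>"

locale l_group = group G for G :: "('a, 'b) ordered_monoid_scheme" (structure) +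
  assumes lattice_order: "lattice (order_of G)"
    and mult_left_mono:
      "\<lbrakk>x \<in> carrier G; y \<in> carrier G; z \<in> carrier G; x \<preceq> y\<rbrakk> \<Longrightarrow> z \<otimes> x \<preceq> z \<otimes> y"
    and mult_right_mono:
      "\<lbrakk>x \<in> carrier G; y \<in> carrier G; z \<in> carrier G; x \<preceq> y\<rbrakk> \<Longrightarrow> x \<otimes> z \<preceq> y \<otimes> z"

locale l_subgroup = subgroup I G for I and G :: "('a, 'b) ordered_monoid_scheme" (structure) +
  assumes join_mem: "\<lbrakk>x \<in> I; y \<in> I\<rbrakk> \<Longrightarrow> x \<squnion>\<^bsub>order_of G\<^esub> y \<in> I"
    and meet_mem: "\<lbrakk>x \<in> I; y \<in> I\<rbrakk> \<Longrightarrow> x \<sqinter>\<^bsub>order_of G\<^esub> y \<in> I"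

locale l_ideal = l_subgroup I G + normal I G for I and G (structure) +
  assumes convex: "\<lbrakk>x \<in> I; z \<in> I; y \<in> carrier G; x \<preceq> y; y \<preceq> z\<rbrakk> \<Longrightarrow> y \<in> I"

definition l_ideal_generated :: "('a, 'b) ordered_monoid_scheme \<Rightarrow> 'a set \<Rightarrow> 'a set"
  where "l_ideal_generated G A = \<Inter>{I. l_ideal I G \<and> A \<subseteq> I}"

definition fg_l_ideals :: "('a, 'b) ordered_monoid_scheme \<Rightarrow> 'a set gorder"
  where "fg_l_ideals G =
    \<lparr>carrier = {l_ideal_generated G A |A. finite A \<and> A \<subseteq> carrier G}, eq = (=), le = (\<subseteq>)\<rparr>"


section \<open>Finitely generated l-ideals form a semilattice with zero\<close>

context l_group
begin

lemma l_ideal_carrier: "l_ideal (carrier G) G"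
proof -
  interpret O: lattice "order_of G" by (rule lattice_order)
  have c: "carrier (order_of G) = carrier G" by (simp add: order_of_def)
  have "carrier G \<lhd> G"
    by (simp add: normal_inv_iff subgroup_self)
  moreover have "l_subgroup (carrier G) G"
    using O.join_closed O.meet_closed c
    by (intro l_subgroup.intro l_subgroup_axioms.intro subgroup_self) auto
  ultimately show ?thesis
    by (intro l_ideal.intro l_ideal_axioms.intro) auto
qed

lemma l_ideal_Inter:
  assumes ne: "F \<noteq> {}" and F: "\<And>I. I \<in> F \<Longrightarrow> l_ideal I G"
  shows "l_ideal (\<Inter>F) G"
proof -
  have n: "I \<lhd> G" and s: "subgroup I G" and l: "l_subgroup I G" if "I \<in> F" for I
    using F[OF that] by (auto simp: l_ideal_def normal_imp_subgroup)
  have sub: "subgroup (\<Inter>F) G"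
    using subgroups_Inter[OF s ne] by simp
  have "\<Inter>F \<lhd> G"
    unfolding normal_inv_iff using sub n by (auto simp: normal_inv_iff)
  moreover have "l_subgroup (\<Inter>F) G"
    using sub l by (intro l_subgroup.intro l_subgroup_axioms.intro)
      (auto simp: l_subgroup_def l_subgroup_axioms_def)
  moreover have "y \<in> I"
    if "x \<in> \<Inter>F" "z \<in> \<Inter>F" "y \<in> carrier G" "x \<preceq> y" "y \<preceq> z" "I \<in> F" for x y z I
    using l_ideal.convex[OF F[OF that(6)]] that by blast
  ultimately show ?thesis
    by (intro l_ideal.intro l_ideal_axioms.intro) blast+
qed

lemma l_ideal_l_ideal_generated:
  "A \<subseteq> carrier G \<Longrightarrow> l_ideal (l_ideal_generated G A) G"
  unfolding l_ideal_generated_def using l_ideal_carrier by (intro l_ideal_Inter) auto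

lemma l_ideal_generated_subset_iff:
  assumes "A \<subseteq> carrier G" "l_ideal I G"
  shows "l_ideal_generated G A \<subseteq> I \<longleftrightarrow> A \<subseteq> I"
  using assms unfolding l_ideal_generated_def by blast

lemma partial_order_fg_l_ideals: "partial_order (fg_l_ideals G)"
  by unfold_locales (auto simp: fg_l_ideals_def)

lemma least_fg_l_ideals_Un:
  assumes A: "finite A" "A \<subseteq> carrier G" and B: "finite B" "B \<subseteq> carrier G"
  shows "least (fg_l_ideals G) (l_ideal_generated G (A \<union> B))
    (Upper (fg_l_ideals G) {l_ideal_generated G A, l_ideal_generated G B})"
proof (rule least_UpperI)
  have AB: "A \<union> B \<subseteq> carrier G" using A B by blast
  have "A \<union> B \<subseteq> l_ideal_generated G (A \<union> B)"
    by (auto simp: l_ideal_generated_def)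
  then have le: "l_ideal_generated G A \<subseteq> l_ideal_generated G (A \<union> B)"
    "l_ideal_generated G B \<subseteq> l_ideal_generated G (A \<union> B)"
    by (simp_all add: l_ideal_generated_subset_iff A B l_ideal_l_ideal_generated AB)
  show "{l_ideal_generated G A, l_ideal_generated G B} \<subseteq> carrier (fg_l_ideals G)"
    and "l_ideal_generated G (A \<union> B) \<in> carrier (fg_l_ideals G)"
    using A B by (auto simp: fg_l_ideals_def)
  show "I \<sqsubseteq>\<^bsub>fg_l_ideals G\<^esub> l_ideal_generated G (A \<union> B)"
    if "I \<in> {l_ideal_generated G A, l_ideal_generated G B}" for I
    using le that by (auto simp: fg_l_ideals_def)
  fix J
  assume "J \<in> Upper (fg_l_ideals G) {l_ideal_generated G A, l_ideal_generated G B}"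
  then have J: "J \<in> carrier (fg_l_ideals G)"
    and "l_ideal_generated G A \<subseteq> J" "l_ideal_generated G B \<subseteq> J"
    using A B by (auto simp: Upper_def fg_l_ideals_def)
  moreover have "l_ideal J G"
    using J l_ideal_l_ideal_generated by (auto simp: fg_l_ideals_def)
  ultimately have "l_ideal_generated G (A \<union> B) \<subseteq> J"
    using A B AB by (simp add: l_ideal_generated_subset_iff)
  then show "l_ideal_generated G (A \<union> B) \<sqsubseteq>\<^bsub>fg_l_ideals G\<^esub> J"
    by (simp add: fg_l_ideals_def)
qed

lemma least_fg_l_ideals_empty:
  "least (fg_l_ideals G) (l_ideal_generated G {}) (carrier (fg_l_ideals G))"
  unfolding least_def fg_l_ideals_def by (fastforce simp: l_ideal_generated_def)

lemma semilattice_zero_fg_l_ideals: "semilattice_zero (fg_l_ideals G)"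
proof -
  interpret partial_order "fg_l_ideals G" by (rule partial_order_fg_l_ideals)
  show ?thesis
  proof unfold_locales
    fix I J
    assume "I \<in> carrier (fg_l_ideals G)" "J \<in> carrier (fg_l_ideals G)"
    then obtain A B where "finite A" "A \<subseteq> carrier G" "I = l_ideal_generated G A"
      "finite B" "B \<subseteq> carrier G" "J = l_ideal_generated G B"
      by (auto simp: fg_l_ideals_def)
    then show "\<exists>s. least (fg_l_ideals G) s (Upper (fg_l_ideals G) {I, J})"
      using least_fg_l_ideals_Un by blast
  qed (use least_fg_l_ideals_empty in blast)
qed

lemma fg_l_ideals_join:
  assumes "finite A" "A \<subseteq> carrier G" "finite B" "B \<subseteq> carrier G"
  shows "l_ideal_generated G A \<squnion>\<^bsub>fg_l_ideals G\<^esub> l_ideal_generated G B =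
    l_ideal_generated G (A \<union> B)"
  unfolding join_def sup_def
  using least_fg_l_ideals_Un[OF assms] partial_order.least_unique[OF partial_order_fg_l_ideals]
  by (intro some_equality)

lemma fg_l_ideals_bottom: "\<bottom>\<^bsub>fg_l_ideals G\<^esub> = l_ideal_generated G {}"
  unfolding bottom_def
  using least_fg_l_ideals_empty partial_order.least_unique[OF partial_order_fg_l_ideals]
  by (intro some_equality)

end

end

theory Submission
  imports Defs Complex_Main
begin

text \<open>
  Let \<open>B\<close> be the \<open>l\<close>-group of order automorphisms of the rationals with bounded support, ordered
  pointwise. It has two properties that make it a building block.

  \<^item> It is simple, in a strong form: if \<open>g \<noteq> 1\<close>, then every \<open>f\<close> satisfies
    \<open>\<bar>f\<bar> \<le> h \<bar>g\<bar> h\<^sup>-\<^sup>1\<close> for a single \<open>h\<close> (lemma \<open>conjugate_dominates\<close>). Hence an element of a finite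
    power \<open>B\<^sup>V\<close> generates exactly the \<open>l\<close>-ideal determined by its support, and the \<open>l\<close>-ideals of
    \<open>B\<^sup>V\<close> form the Boolean semilattice \<open>2\<^sup>V\<close>.

  \<^item> Its powers embed into it: place disjoint copies of the rationals inside one bounded interval
    and let each coordinate act on its own copy. Doing so separately for each target coordinate, any
    join homomorphism \<open>2\<^sup>V \<rightarrow> 2\<^sup>W\<close>, given by a relation \<open>v \<mapsto> E v \<subseteq> W\<close>, is induced by a homomorphism
    of \<open>l\<close>-groups \<open>B\<^sup>V \<rightarrow> B\<^sup>W\<close>, called \<open>lift E\<close> below.

  A countable distributive semilattice \<open>S\<close> is the limit of a sequence of finite Boolean semilattices
  \<open>2\<^bsup>V n\<^esup>\<close>. The sequence is built together with labels \<open>\<phi> n v\<close> in \<open>S\<close> of the atoms: each label is the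
  join of the labels of the children of its atom, and each element of \<open>S\<close> occurs as a label. An
  inequality between joins of labels at level \<open>n\<close> need not be an inclusion of sets of atoms, but
  distributivity allows the atoms to be split so that it becomes one at level \<open>n + 1\<close>
  (lemmas \<open>split_dominated\<close> and \<open>refinement_diagram_exists\<close>).

  The required \<open>l\<close>-group is the direct limit of the powers \<open>B\<^bsup>V n\<^esup>\<close> along the lifts. To an element of
  it, attach the join of the labels of the support of its components at a late level; this value does
  not depend on the level. The elements with value at most \<open>s\<close> form an \<open>l\<close>-ideal. If the value of
  \<open>f\<close> lies below that of \<open>g\<close>, then from some level on the support of \<open>f\<close> is contained in that of \<open>g\<close>,
  and strong simplicity in each coordinate puts \<open>f\<close> into the \<open>l\<close>-ideal generated by \<open>g\<close>
  (lemma \<open>mem_l_ideal_generated\<close>). So the finitely generated \<open>l\<close>-ideals correspond to the values,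
  which are all the elements of \<open>S\<close> (lemma \<open>semilattice_zero_iso_fg_l_ideals\<close>).
\<close>

section \<open>Refinement diagrams of a distributive semilattice\<close>

text \<open>
  The relation \<open>v \<mapsto> E v\<close> is a join homomorphism from the subsets of \<open>V\<close> to those of \<open>V'\<close>, and the
  last conjunct says that \<open>\<phi> v\<close> is the join of \<open>\<phi>'\<close> over \<open>E v\<close>. Joins are described by their upper
  bounds, so that the join over an empty \<open>E v\<close>, which is \<open>0\<close>, needs no separate treatment.
\<close>

definition refines ::
    "('a, 'b) gorder_scheme \<Rightarrow> nat set \<Rightarrow> (nat \<Rightarrow> 'a) \<Rightarrow> (nat \<Rightarrow> nat set) \<Rightarrow> nat set \<Rightarrow> (nat \<Rightarrow> 'a) \<Rightarrow> bool"
  where "refines L V \<phi> E V' \<phi>' \<longleftrightarrow>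
    finite V' \<and> \<phi>' ` V' \<subseteq> carrier L \<and> (\<forall>v. E v \<subseteq> V') \<and>
    (\<forall>v\<in>V. \<forall>s\<in>carrier L. \<phi> v \<sqsubseteq>\<^bsub>L\<^esub> s \<longleftrightarrow> (\<forall>w\<in>E v. \<phi>' w \<sqsubseteq>\<^bsub>L\<^esub> s))"

text \<open>
  The join of \<open>\<phi>\<close> over \<open>A\<close> lies below the join of \<open>\<phi>\<close> over \<open>B\<close>.
\<close>

definition dominated :: "('a, 'b) gorder_scheme \<Rightarrow> (nat \<Rightarrow> 'a) \<Rightarrow> nat set \<Rightarrow> nat set \<Rightarrow> bool"
  where "dominated L \<phi> A B \<longleftrightarrow>
    (\<forall>s\<in>carrier L. (\<forall>b\<in>B. \<phi> b \<sqsubseteq>\<^bsub>L\<^esub> s) \<longrightarrow> (\<forall>a\<in>A. \<phi> a \<sqsubseteq>\<^bsub>L\<^esub> s))"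

lemma refines_comp:
  assumes "refines L V \<phi> E V' \<phi>'" "refines L V' \<phi>' F V'' \<phi>''"
  shows "refines L V \<phi> (\<lambda>v. \<Union>w\<in>E v. F w) V'' \<phi>''"
  using assms unfolding refines_def by (simp add: subset_iff) meson

lemma dominated_step:
  assumes r: "refines L V \<phi> E V' \<phi>'" and "A \<subseteq> V" "B \<subseteq> V" and "dominated L \<phi> A B"
  shows "dominated L \<phi>' (\<Union>v\<in>A. E v) (\<Union>v\<in>B. E v)"
  using assms unfolding refines_def dominated_def subset_iff by (metis UN_E UN_I)

context distributive_semilattice_zero
begin

lemma finite_least_upper_bound:
  assumes "finite C" "\<phi> ` C \<subseteq> carrier L"
  obtains u where "u \<in> carrier L" "\<And>s. s \<in> carrier L \<Longrightarrow> u \<sqsubseteq> s \<longleftrightarrow> (\<forall>c\<in>C. \<phi> c \<sqsubseteq> s)"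
proof -
  have "\<exists>u\<in>carrier L. \<forall>s\<in>carrier L. u \<sqsubseteq> s \<longleftrightarrow> (\<forall>c\<in>C. \<phi> c \<sqsubseteq> s)"
    using assms
  proof (induction C)
    case empty
    then show ?case using bottom_closed bottom_lower by blast
  next
    case (insert c C)
    then obtain u where u: "u \<in> carrier L" "\<forall>s\<in>carrier L. u \<sqsubseteq> s \<longleftrightarrow> (\<forall>c\<in>C. \<phi> c \<sqsubseteq> s)"
      by auto
    have c: "\<phi> c \<in> carrier L" using insert by auto
    have "\<phi> c \<squnion> u \<sqsubseteq> s \<longleftrightarrow> \<phi> c \<sqsubseteq> s \<and> u \<sqsubseteq> s" if "s \<in> carrier L" for s
      using that c u(1) by (meson join_closed join_le join_left join_right le_trans)
    then show ?case using u c by (intro bexI[of _ "\<phi> c \<squnion> u"]) auto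
  qed
  then show thesis using that by blast
qed

text \<open>
  If \<open>d\<close> lies below the join of the \<open>\<phi> c\<close>, then \<open>d\<close> is a join of elements \<open>x c\<close> with \<open>x c \<sqsubseteq> \<phi> c\<close>:
  distributivity splits off one \<open>c\<close> at a time, and what is left of \<open>d\<close> lies below the join of the
  others.
\<close>

lemma finite_refinement:
  assumes "finite C" "\<phi> ` C \<subseteq> carrier L" "d \<in> carrier L"
    and "\<And>s. s \<in> carrier L \<Longrightarrow> \<forall>c\<in>C. \<phi> c \<sqsubseteq> s \<Longrightarrow> d \<sqsubseteq> s"
  shows "\<exists>x. (\<forall>c\<in>C. x c \<in> carrier L \<and> x c \<sqsubseteq> \<phi> c) \<and>
      (\<forall>s\<in>carrier L. d \<sqsubseteq> s \<longleftrightarrow> (\<forall>c\<in>C. x c \<sqsubseteq> s))"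
  using assms
proof (induction C arbitrary: d)
  case empty
  then show ?case by simp
next
  case (insert b C)
  have \<phi>: "\<phi> b \<in> carrier L" "\<phi> ` C \<subseteq> carrier L" using insert.prems by auto
  obtain u where u: "u \<in> carrier L"
    "\<And>s. s \<in> carrier L \<Longrightarrow> u \<sqsubseteq> s \<longleftrightarrow> (\<forall>c\<in>C. \<phi> c \<sqsubseteq> s)"
    using finite_least_upper_bound[OF insert.hyps(1) \<phi>(2)] by blast
  have "\<phi> b \<sqsubseteq> \<phi> b \<squnion> u" "\<forall>c\<in>C. \<phi> c \<sqsubseteq> \<phi> b \<squnion> u"
    using join_left[OF \<phi>(1) u(1)] join_right[OF \<phi>(1) u(1)] u(2)[OF join_closed[OF \<phi>(1) u(1)]]
    by simp_all
  then have "d \<sqsubseteq> \<phi> b \<squnion> u"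
    using insert.prems(3) \<phi> u(1) by simp
  then obtain b' u' where d: "b' \<in> carrier L" "u' \<in> carrier L" "b' \<sqsubseteq> \<phi> b" "u' \<sqsubseteq> u" "d = b' \<squnion> u'"
    using refinement[OF \<phi>(1) u(1) insert.prems(2)] by blast
  have u': "u' \<sqsubseteq> s" if "s \<in> carrier L" "\<forall>c\<in>C. \<phi> c \<sqsubseteq> s" for s
    using le_trans[OF d(4)] that u d(2) by simp
  have "\<exists>x. (\<forall>c\<in>C. x c \<in> carrier L \<and> x c \<sqsubseteq> \<phi> c) \<and>
      (\<forall>s\<in>carrier L. u' \<sqsubseteq> s \<longleftrightarrow> (\<forall>c\<in>C. x c \<sqsubseteq> s))"
    by (rule insert.IH[OF \<phi>(2) d(2)]) (rule u')
  then obtain x where x: "\<forall>c\<in>C. x c \<in> carrier L \<and> x c \<sqsubseteq> \<phi> c"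
    "\<forall>s\<in>carrier L. u' \<sqsubseteq> s \<longleftrightarrow> (\<forall>c\<in>C. x c \<sqsubseteq> s)"
    by (elim exE conjE)
  have "d \<sqsubseteq> s \<longleftrightarrow> b' \<sqsubseteq> s \<and> u' \<sqsubseteq> s" if "s \<in> carrier L" for s
    unfolding d(5) using that d(1,2) by (meson join_closed join_le join_left join_right le_trans)
  then show ?case
    using x d insert.hyps(2) by (intro exI[of _ "x(b := b')"]) auto
qed

text \<open>
  Every label \<open>\<phi> a\<close> with \<open>a \<in> A\<close> is a join of pieces \<open>x a c\<close> below \<open>\<phi> c\<close>, for \<open>c \<in> B\<close>. The atom \<open>a\<close> is
  replaced by atoms \<open>(a, c)\<close> carrying these pieces, and \<open>(a, c)\<close> is made a child of \<open>a\<close> and of \<open>c\<close>.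
  The label of \<open>c\<close> remains the join over its children, because the added ones are smaller; and each
  child of a member of \<open>A\<close> is now a child of a member of \<open>B\<close>. The sets \<open>A\<close> and \<open>B\<close> may overlap.
\<close>

lemma split_dominated:
  assumes fin: "finite V" and \<phi>: "\<phi> ` V \<subseteq> carrier L"
    and AB: "A \<subseteq> V" "B \<subseteq> V" "dominated L \<phi> A B"
  shows "\<exists>V' \<phi>' E. refines L V \<phi> E V' \<phi>' \<and> (\<Union>v\<in>A. E v) \<subseteq> (\<Union>v\<in>B. E v)"
proof -
  have "\<exists>x. (\<forall>c\<in>B. x c \<in> carrier L \<and> x c \<sqsubseteq> \<phi> c) \<and>
      (\<forall>s\<in>carrier L. \<phi> a \<sqsubseteq> s \<longleftrightarrow> (\<forall>c\<in>B. x c \<sqsubseteq> s))" if "a \<in> A" for a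
  proof -
    have B: "finite B" using fin AB(2) finite_subset by blast
    have \<phi>B: "\<phi> ` B \<subseteq> carrier L" "\<phi> a \<in> carrier L" using \<phi> AB that by blast+
    have "\<phi> a \<sqsubseteq> s" if "s \<in> carrier L" "\<forall>c\<in>B. \<phi> c \<sqsubseteq> s" for s
      using AB(3) that \<open>a \<in> A\<close> unfolding dominated_def by blast
    then show ?thesis by (rule finite_refinement[OF B \<phi>B])
  qed
  then have "\<exists>x. \<forall>a\<in>A. (\<forall>c\<in>B. x a c \<in> carrier L \<and> x a c \<sqsubseteq> \<phi> c) \<and>
      (\<forall>s\<in>carrier L. \<phi> a \<sqsubseteq> s \<longleftrightarrow> (\<forall>c\<in>B. x a c \<sqsubseteq> s))"
    by (intro bchoice ballI)
  then obtain x where "\<forall>a\<in>A. (\<forall>c\<in>B. x a c \<in> carrier L \<and> x a c \<sqsubseteq> \<phi> c) \<and>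
      (\<forall>s\<in>carrier L. \<phi> a \<sqsubseteq> s \<longleftrightarrow> (\<forall>c\<in>B. x a c \<sqsubseteq> s))" by (elim exE)
  then have x: "\<And>a c. a \<in> A \<Longrightarrow> c \<in> B \<Longrightarrow> x a c \<in> carrier L \<and> x a c \<sqsubseteq> \<phi> c"
      "\<And>a s. a \<in> A \<Longrightarrow> s \<in> carrier L \<Longrightarrow> \<phi> a \<sqsubseteq> s \<longleftrightarrow> (\<forall>c\<in>B. x a c \<sqsubseteq> s)"
    by simp_all
  define W where "W = Inl ` (V - A) \<union> Inr ` (A \<times> B)"
  define E where "E v = to_nat ` {w \<in> W. case w of Inl u \<Rightarrow> u = v | Inr (a, c) \<Rightarrow> a = v \<or> c = v}" for v
  define \<phi>' where "\<phi>' w = (case from_nat w of Inl u \<Rightarrow> \<phi> u | Inr (a, c) \<Rightarrow> x a c)" for w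
  have fW: "finite W" unfolding W_def using fin AB finite_subset by blast
  have E: "w \<in> to_nat ` W" if "w \<in> E v" for v w using that unfolding E_def by auto
  have \<phi>'W: "\<phi>' (to_nat w) \<in> carrier L" if "w \<in> W" for w
    using that \<phi> x(1) unfolding W_def \<phi>'_def by auto
  have step: "\<phi> v \<sqsubseteq> s \<longleftrightarrow> (\<forall>w\<in>E v. \<phi>' w \<sqsubseteq> s)" if v: "v \<in> V" and s: "s \<in> carrier L" for v s
  proof
    assume le: "\<phi> v \<sqsubseteq> s"
    have "x a v \<sqsubseteq> s" if "a \<in> A" "v \<in> B" for a
      using le_trans[of "x a v" "\<phi> v" s] x(1)[OF that] le s \<phi> v by auto
    moreover have "x v c \<sqsubseteq> s" if "v \<in> A" "c \<in> B" for c
      using x(2)[OF that(1) s] le that(2) by blast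
    ultimately show "\<forall>w\<in>E v. \<phi>' w \<sqsubseteq> s"
      using le unfolding E_def \<phi>'_def W_def by auto
  next
    assume *: "\<forall>w\<in>E v. \<phi>' w \<sqsubseteq> s"
    show "\<phi> v \<sqsubseteq> s"
    proof (cases "v \<in> A")
      case True
      then have "x v c \<sqsubseteq> s" if "c \<in> B" for c
        using *[rule_format, of "to_nat (Inr (v, c) :: nat + nat \<times> nat)"] that
        unfolding E_def \<phi>'_def W_def by auto
      then show ?thesis using x(2)[OF True s] by blast
    next
      case False
      then show ?thesis
        using *[rule_format, of "to_nat (Inl v :: nat + nat \<times> nat)"] v
        unfolding E_def \<phi>'_def W_def by auto
    qed
  qed
  have "refines L V \<phi> E (to_nat ` W) \<phi>'"
    unfolding refines_def
  proof (intro conjI allI ballI)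
    show "finite (to_nat ` W)" using fW by simp
    show "\<phi>' ` to_nat ` W \<subseteq> carrier L" using \<phi>'W by blast
    show "E v \<subseteq> to_nat ` W" for v using E by blast
  qed (fact step)
  moreover have "(\<Union>v\<in>A. E v) \<subseteq> (\<Union>v\<in>B. E v)"
    unfolding E_def W_def by fastforce
  ultimately show ?thesis by blast
qed

text \<open>
  The dominations are treated one after another: a later refinement preserves both the inclusions
  already achieved and the dominations still to be treated.
\<close>

lemma refine_finitely_many:
  assumes fin: "finite V" and \<phi>: "\<phi> ` V \<subseteq> carrier L" and "finite T"
    and "\<And>A B. (A, B) \<in> T \<Longrightarrow> A \<subseteq> V \<and> B \<subseteq> V \<and> dominated L \<phi> A B"
  shows "\<exists>V' \<phi>' E. refines L V \<phi> E V' \<phi>' \<and> (\<forall>(A, B)\<in>T. (\<Union>v\<in>A. E v) \<subseteq> (\<Union>v\<in>B. E v))"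
  using assms(3,4)
proof (induction T)
  case empty
  have "(\<forall>w\<in>{v} \<inter> V. \<phi> w \<sqsubseteq> s) \<longleftrightarrow> \<phi> v \<sqsubseteq> s" if "v \<in> V" for v s using that by blast
  then have "refines L V \<phi> (\<lambda>v. {v} \<inter> V) V \<phi>"
    using fin \<phi> unfolding refines_def by simp
  then show ?case by (intro exI conjI) (assumption, simp)
next
  case (insert t T)
  obtain A B where t: "t = (A, B)" by fastforce
  then have AB: "A \<subseteq> V" "B \<subseteq> V" "dominated L \<phi> A B" using insert.prems by auto
  have "\<exists>V' \<phi>' E. refines L V \<phi> E V' \<phi>' \<and>
      (\<forall>(A, B)\<in>T. (\<Union>v\<in>A. E v) \<subseteq> (\<Union>v\<in>B. E v))"
    by (rule insert.IH) (rule insert.prems, simp)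
  then obtain V' \<phi>' E where E: "refines L V \<phi> E V' \<phi>'"
    "\<forall>(A, B)\<in>T. (\<Union>v\<in>A. E v) \<subseteq> (\<Union>v\<in>B. E v)" by (elim exE conjE)
  have "finite V'" "\<phi>' ` V' \<subseteq> carrier L" "(\<Union>v\<in>A. E v) \<subseteq> V'" "(\<Union>v\<in>B. E v) \<subseteq> V'"
    using E(1) unfolding refines_def by auto
  from split_dominated[OF this dominated_step[OF E(1) AB]]
  obtain V'' \<phi>'' F where F: "refines L V' \<phi>' F V'' \<phi>''"
    "(\<Union>w\<in>(\<Union>v\<in>A. E v). F w) \<subseteq> (\<Union>w\<in>(\<Union>v\<in>B. E v). F w)" by (elim exE conjE)
  show ?case
  proof (intro exI conjI)
    show "refines L V \<phi> (\<lambda>v. \<Union>w\<in>E v. F w) V'' \<phi>''"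
      by (rule refines_comp[OF E(1) F(1)])
    show "\<forall>(A, B)\<in>insert t T. (\<Union>v\<in>A. \<Union>w\<in>E v. F w) \<subseteq> (\<Union>v\<in>B. \<Union>w\<in>E v. F w)"
    proof (intro ballI)
      fix p
      assume p: "p \<in> insert t T"
      obtain A' B' where p': "p = (A', B')" by fastforce
      have "(\<Union>v\<in>A'. \<Union>w\<in>E v. F w) \<subseteq> (\<Union>v\<in>B'. \<Union>w\<in>E v. F w)"
      proof (cases "p = t")
        case True
        then show ?thesis using F(2) p' t by auto
      next
        case False
        then have "(\<Union>v\<in>A'. E v) \<subseteq> (\<Union>v\<in>B'. E v)" using E(2) p p' by blast
        then show ?thesis by blast
      qed
      then show "case p of (A, B) \<Rightarrow> (\<Union>v\<in>A. \<Union>w\<in>E v. F w) \<subseteq> (\<Union>v\<in>B. \<Union>w\<in>E v. F w)"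
        using p' by simp
    qed
  qed
qed

lemma refine_all:
  assumes fin: "finite V" and \<phi>: "\<phi> ` V \<subseteq> carrier L" and s: "s \<in> carrier L"
  shows "\<exists>V' \<phi>' E. refines L V \<phi> E V' \<phi>' \<and> s \<in> \<phi>' ` V' \<and>
    (\<forall>A\<subseteq>V. \<forall>B\<subseteq>V. dominated L \<phi> A B \<longrightarrow> (\<Union>v\<in>A. E v) \<subseteq> (\<Union>v\<in>B. E v))"
proof -
  define T where "T = {(A, B). A \<subseteq> V \<and> B \<subseteq> V \<and> dominated L \<phi> A B}"
  have "finite T"
  proof (rule finite_subset)
    show "T \<subseteq> Pow V \<times> Pow V" unfolding T_def by blast
    show "finite (Pow V \<times> Pow V)" using fin by simp
  qed
  have "\<exists>V' \<phi>' E. refines L V \<phi> E V' \<phi>' \<and>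
      (\<forall>(A, B)\<in>T. (\<Union>v\<in>A. E v) \<subseteq> (\<Union>v\<in>B. E v))"
    by (rule refine_finitely_many[OF fin \<phi> \<open>finite T\<close>]) (simp add: T_def)
  then obtain V' \<phi>' E where E: "refines L V \<phi> E V' \<phi>'"
    "\<forall>(A, B)\<in>T. (\<Union>v\<in>A. E v) \<subseteq> (\<Union>v\<in>B. E v)" by (elim exE conjE)
  have V': "finite V'" "\<phi>' ` V' \<subseteq> carrier L" using E(1) unfolding refines_def by simp_all
  \<comment> \<open>shifting the old atoms by one frees the name 0 for a new atom labelled s, which has no parent\<close>
  have "refines L V' \<phi>' (\<lambda>v. Suc ` ({v} \<inter> V')) (insert 0 (Suc ` V')) (case_nat s \<phi>')"
    unfolding refines_def
  proof (intro conjI allI ballI)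
    show "finite (insert 0 (Suc ` V'))" using V'(1) by simp
    show "case_nat s \<phi>' ` insert 0 (Suc ` V') \<subseteq> carrier L"
      using V'(2) s by (simp add: image_image)
    show "Suc ` ({v} \<inter> V') \<subseteq> insert 0 (Suc ` V')" for v by blast
    show "\<phi>' v \<sqsubseteq> t \<longleftrightarrow> (\<forall>w\<in>Suc ` ({v} \<inter> V'). case_nat s \<phi>' w \<sqsubseteq> t)" if "v \<in> V'" for v t
      using that by simp
  qed
  note r = refines_comp[OF E(1) this]
  have sub: "(\<Union>v\<in>A. \<Union>w\<in>E v. Suc ` ({w} \<inter> V')) \<subseteq> (\<Union>v\<in>B. \<Union>w\<in>E v. Suc ` ({w} \<inter> V'))"
    if "A \<subseteq> V" "B \<subseteq> V" "dominated L \<phi> A B" for A B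
  proof -
    have "(\<Union>v\<in>A. E v) \<subseteq> (\<Union>v\<in>B. E v)" using E(2) that unfolding T_def by blast
    then show ?thesis by blast
  qed
  show ?thesis
  proof (intro exI conjI allI impI)
    show "s \<in> case_nat s \<phi>' ` insert 0 (Suc ` V')" by simp
  qed (fact r, fact sub)
qed

lemma refinement_diagram_exists:
  assumes "countable (carrier L)"
  obtains V :: "nat \<Rightarrow> nat set" and \<phi> :: "nat \<Rightarrow> nat \<Rightarrow> 'a" and E :: "nat \<Rightarrow> nat \<Rightarrow> nat set"
  where "\<And>n. refines L (V n) (\<phi> n) (E n) (V (Suc n)) (\<phi> (Suc n))"
    and "\<And>n A B. A \<subseteq> V n \<Longrightarrow> B \<subseteq> V n \<Longrightarrow> dominated L (\<phi> n) A B \<Longrightarrow>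
      (\<Union>v\<in>A. E n v) \<subseteq> (\<Union>v\<in>B. E n v)"
    and "\<And>s. s \<in> carrier L \<Longrightarrow> \<exists>n. s \<in> \<phi> (Suc n) ` V (Suc n)"
proof -
  define g where "g = from_nat_into (carrier L)"
  have ne: "carrier L \<noteq> {}" using bottom_closed by blast
  have g: "g n \<in> carrier L" for n unfolding g_def by (rule from_nat_into[OF ne])
  define good where "good n x y E \<longleftrightarrow>
      refines L (fst x) (snd x) E (fst y) (snd y) \<and> g n \<in> snd y ` fst y \<and>
      (\<forall>A\<subseteq>fst x. \<forall>B\<subseteq>fst x. dominated L (snd x) A B \<longrightarrow> (\<Union>v\<in>A. E v) \<subseteq> (\<Union>v\<in>B. E v))"
    for n :: nat and x y :: "nat set \<times> (nat \<Rightarrow> 'a)" and E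
  define level where "level x \<longleftrightarrow> finite (fst x) \<and> snd x ` fst x \<subseteq> carrier L"
    for x :: "nat set \<times> (nat \<Rightarrow> 'a)"
  have "\<exists>y. level y \<and> (\<exists>E. good n x y E)" if "level x" for x n
  proof -
    have fin: "finite (fst x)" "snd x ` fst x \<subseteq> carrier L" using that unfolding level_def by simp_all
    from refine_all[OF fin g[of n]] obtain V' \<phi>' E where E: "refines L (fst x) (snd x) E V' \<phi>' \<and>
      g n \<in> \<phi>' ` V' \<and> (\<forall>A\<subseteq>fst x. \<forall>B\<subseteq>fst x. dominated L (snd x) A B \<longrightarrow> (\<Union>v\<in>A. E v) \<subseteq> (\<Union>v\<in>B. E v))"
      by (elim exE)
    then have "level (V', \<phi>')" unfolding level_def refines_def by simp
    moreover have "good n x (V', \<phi>') E" unfolding good_def fst_conv snd_conv by (rule E)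
    ultimately show ?thesis by (intro exI conjI)
  qed
  moreover have "\<exists>x. level x" unfolding level_def by (rule exI[of _ "({}, undefined)"]) simp
  ultimately have "\<exists>f. \<forall>n. level (f n) \<and> (\<exists>E. good n (f n) (f (Suc n)) E)"
    by (intro dependent_nat_choice)
  then obtain f where "\<forall>n. \<exists>E. good n (f n) (f (Suc n)) E" by blast
  then obtain E where E: "\<And>n. good n (f n) (f (Suc n)) (E n)" by metis
  show thesis
  proof (rule that)
    show "refines L (fst (f n)) (snd (f n)) (E n) (fst (f (Suc n))) (snd (f (Suc n)))" for n
      using E[of n] unfolding good_def by (elim conjE)
    show "(\<Union>v\<in>A. E n v) \<subseteq> (\<Union>v\<in>B. E n v)"
      if "A \<subseteq> fst (f n)" "B \<subseteq> fst (f n)" "dominated L (snd (f n)) A B" for n A B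
      using E[of n] that unfolding good_def by (elim conjE) simp
    show "\<exists>n. s \<in> snd (f (Suc n)) ` fst (f (Suc n))" if "s \<in> carrier L" for s
      using E[of "to_nat_on (carrier L) s"] from_nat_into_to_nat_on[OF assms that]
      unfolding good_def g_def by (intro exI[of _ "to_nat_on (carrier L) s"]) simp
  qed
qed

end

section \<open>Order automorphisms of the rationals with bounded support\<close>

definition bounded_auts :: "(rat \<Rightarrow> rat) set"
  where "bounded_auts = {f. strict_mono f \<and> surj f \<and> (\<exists>a b. \<forall>q. f q \<noteq> q \<longrightarrow> a < q \<and> q < b)}"

abbreviation aut_inv :: "(rat \<Rightarrow> rat) \<Rightarrow> rat \<Rightarrow> rat"
  where "aut_inv f \<equiv> inv_into UNIV f"

lemma bounded_auts_bij: "f \<in> bounded_auts \<Longrightarrow> bij f"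
  by (auto simp: bounded_auts_def bij_def strict_mono_imp_inj_on)

lemma bounded_auts_inv_apply [simp]:
  assumes "f \<in> bounded_auts"
  shows "aut_inv f (f x) = x" "f (aut_inv f x) = x"
  using bounded_auts_bij[OF assms] by (simp_all add: bij_is_inj bij_is_surj surj_f_inv_f)

lemma bounded_auts_mono: "f \<in> bounded_auts \<Longrightarrow> f x \<le> f y \<longleftrightarrow> x \<le> y"
  by (auto simp: bounded_auts_def strict_mono_less_eq)

lemma bounded_auts_less: "f \<in> bounded_auts \<Longrightarrow> f x < f y \<longleftrightarrow> x < y"
  by (auto simp: bounded_auts_def strict_mono_less)

lemma id_bounded_auts: "id \<in> bounded_auts"
  by (auto simp: bounded_auts_def strict_mono_def)

lemma comp_bounded_auts:
  assumes f: "f \<in> bounded_auts" and g: "g \<in> bounded_auts"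
  shows "f \<circ> g \<in> bounded_auts"
proof -
  obtain a b c d where "\<And>q. f q \<noteq> q \<Longrightarrow> a < q \<and> q < b" "\<And>q. g q \<noteq> q \<Longrightarrow> c < q \<and> q < d"
    using f g unfolding bounded_auts_def by blast
  then have "\<forall>q. (f \<circ> g) q \<noteq> q \<longrightarrow> min a c < q \<and> q < max b d"
    by (metis comp_apply max_less_iff_conj less_max_iff_disj min_less_iff_disj)
  moreover have "surj (f \<circ> g)"
    using f g by (intro comp_surj) (auto simp: bounded_auts_def)
  ultimately show ?thesis
    using f g unfolding bounded_auts_def by (auto simp: strict_mono_def)
qed

lemma inv_bounded_auts:
  assumes f: "f \<in> bounded_auts"
  shows "aut_inv f \<in> bounded_auts"
proof -
  have "aut_inv f x < aut_inv f y \<longleftrightarrow> x < y" for x y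
    using bounded_auts_less[OF f, of "aut_inv f x" "aut_inv f y"] f by simp
  moreover obtain a b where "\<And>q. f q \<noteq> q \<Longrightarrow> a < q \<and> q < b"
    using f unfolding bounded_auts_def by blast
  then have "\<forall>q. aut_inv f q \<noteq> q \<longrightarrow> a < q \<and> q < b"
    using bounded_auts_inv_apply[OF f] by metis
  ultimately show ?thesis
    using bij_imp_bij_inv[OF bounded_auts_bij[OF f]]
    unfolding bounded_auts_def by (auto simp: strict_mono_def bij_is_surj)
qed

text \<open>
  The pointwise maximum is onto: the smaller one of the preimages of \<open>y\<close> under \<open>f\<close> and \<open>g\<close> is a
  preimage under the maximum, since the other function takes a value of at most \<open>y\<close> there.
\<close>

lemma sup_bounded_auts:
  assumes f: "f \<in> bounded_auts" and g: "g \<in> bounded_auts"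
  shows "sup f g \<in> bounded_auts"
proof -
  have "y \<in> range (sup f g)" for y
  proof -
    have "y = sup f g (min (aut_inv f y) (aut_inv g y))"
    proof (cases "aut_inv f y \<le> aut_inv g y")
      case True
      then have "g (aut_inv f y) \<le> y"
        using bounded_auts_mono[OF g, of "aut_inv f y" "aut_inv g y"] g by simp
      then show ?thesis using f True by (simp add: sup_max min_absorb1 max_absorb1)
    next
      case False
      then have "f (aut_inv g y) \<le> y"
        using bounded_auts_mono[OF f, of "aut_inv g y" "aut_inv f y"] f by simp
      then show ?thesis using g False by (simp add: sup_max min_absorb2 max_absorb2)
    qed
    then show ?thesis by blast
  qed
  then have "surj (sup f g)" by blast
  moreover have "strict_mono (sup f g)"
    using f g unfolding bounded_auts_def strict_mono_def
    by (auto simp: sup_max max_def not_le) (meson less_le_trans less_trans not_le)+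
  moreover obtain a b c d where "\<And>q. f q \<noteq> q \<Longrightarrow> a < q \<and> q < b" "\<And>q. g q \<noteq> q \<Longrightarrow> c < q \<and> q < d"
    using f g unfolding bounded_auts_def by blast
  then have "\<forall>q. (sup f g) q \<noteq> q \<longrightarrow> min a c < q \<and> q < max b d"
    by (metis sup_fun_def sup_idem max_less_iff_conj less_max_iff_disj min_less_iff_disj)
  ultimately show ?thesis unfolding bounded_auts_def by blast
qed

lemma inf_eq_inv_sup_inv:
  assumes f: "f \<in> bounded_auts" and g: "g \<in> bounded_auts"
  shows "inf f g = aut_inv (sup (aut_inv f) (aut_inv g))"
proof
  fix q
  have h: "sup (aut_inv f) (aut_inv g) \<in> bounded_auts"
    by (intro sup_bounded_auts inv_bounded_auts f g)
  have "sup (aut_inv f) (aut_inv g) (inf f g q) = q"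
  proof (cases "f q \<le> g q")
    case True
    then have "aut_inv g (f q) \<le> q"
      using bounded_auts_mono[OF g, of "aut_inv g (f q)" q] g by simp
    then show ?thesis using True f by (simp add: inf_min sup_max max_absorb1)
  next
    case False
    then have "aut_inv f (g q) \<le> q"
      using bounded_auts_mono[OF f, of "aut_inv f (g q)" q] f by simp
    then show ?thesis using False g by (simp add: inf_min sup_max max_absorb2)
  qed
  then show "inf f g q = aut_inv (sup (aut_inv f) (aut_inv g)) q"
    using h by (metis bounded_auts_inv_apply(1))
qed

lemma inf_bounded_auts:
  "f \<in> bounded_auts \<Longrightarrow> g \<in> bounded_auts \<Longrightarrow> inf f g \<in> bounded_auts"
  by (simp add: inf_eq_inv_sup_inv inv_bounded_auts sup_bounded_auts)

lemma inv_le_swap: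
  assumes f: "f \<in> bounded_auts" and y: "y \<in> bounded_auts" and le: "aut_inv f \<le> y"
  shows "aut_inv y \<le> f"
proof (rule le_funI)
  fix q
  have "aut_inv f (f q) \<le> y (f q)" using le by (rule le_funD)
  then have "y (aut_inv y q) \<le> y (f q)" using f y by simp
  then show "aut_inv y q \<le> f q" using bounded_auts_mono[OF y] by simp
qed

lemma eq_id_if_le_id:
  assumes f: "f \<in> bounded_auts" and "f \<le> id" "aut_inv f \<le> id"
  shows "f = id"
proof (rule antisym)
  show "id \<le> f" using inv_le_swap[OF f id_bounded_auts assms(3)] by simp
qed fact

text \<open>
  The piecewise linear map that fixes everything outside the interval from \<open>L\<close> to \<open>U\<close> and has
  a single breakpoint \<open>c\<close> inside it, which is sent to \<open>d\<close>.
\<close>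

definition bump :: "rat \<Rightarrow> rat \<Rightarrow> rat \<Rightarrow> rat \<Rightarrow> rat \<Rightarrow> rat"
  where "bump L c d U q =
    (if q \<le> L \<or> U \<le> q then q
     else if q \<le> c then L + (q - L) * ((d - L) / (c - L))
     else U - (U - q) * ((U - d) / (U - c)))"

lemma bump_between:
  assumes "L < c" "c < U" "L < d" "d < U" "L < q" "q < U"
  shows "L < bump L c d U q \<and> bump L c d U q < U \<and> (bump L c d U q \<le> d \<longleftrightarrow> q \<le> c)"
proof (cases "q \<le> c")
  case True
  have pos: "0 < (d - L) / (c - L)" using assms by simp
  have "(q - L) * ((d - L) / (c - L)) \<le> (c - L) * ((d - L) / (c - L))"
    using True pos by (intro mult_right_mono) auto
  moreover have "0 < (q - L) * ((d - L) / (c - L))"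
    using assms pos by (intro mult_pos_pos) auto
  ultimately show ?thesis using assms True by (auto simp: bump_def)
next
  case False
  have pos: "0 < (U - d) / (U - c)" using assms by simp
  have "(U - q) * ((U - d) / (U - c)) < (U - c) * ((U - d) / (U - c))"
    using False pos by (intro mult_strict_right_mono) auto
  moreover have "0 < (U - q) * ((U - d) / (U - c))"
    using assms pos by (intro mult_pos_pos) auto
  ultimately show ?thesis using assms False by (auto simp: bump_def)
qed

lemma bump_inverse:
  assumes "L < c" "c < U" "L < d" "d < U"
  shows "bump L d c U (bump L c d U q) = q"
proof (cases "L < q \<and> q < U")
  case True
  then show ?thesis
    using bump_between[OF assms, of q] assms
    by (subst bump_def) (auto simp: bump_def)
next
  case False
  then show ?thesis by (auto simp: bump_def)
qed

lemma bump_strict_mono: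
  assumes "L < c" "c < U" "L < d" "d < U"
  shows "strict_mono (bump L c d U)"
proof (rule strict_monoI)
  fix p q :: rat
  assume pq: "p < q"
  consider "p \<le> L \<or> U \<le> q" | "L < p" "q \<le> c" | "L < p" "p \<le> c" "c < q" "q < U" | "c < p" "q < U"
    by linarith
  then show "bump L c d U p < bump L c d U q"
  proof cases
    case 1
    then show ?thesis
      using bump_between[OF assms, of p] bump_between[OF assms, of q] pq
      by (auto simp: bump_def)
  next
    case 2
    have "(p - L) * ((d - L) / (c - L)) < (q - L) * ((d - L) / (c - L))"
      using assms pq by (intro mult_strict_right_mono) auto
    then show ?thesis using 2 assms pq by (auto simp: bump_def)
  next
    case 3
    then show ?thesis
      using bump_between[OF assms, of p] bump_between[OF assms, of q] pq by auto
  next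
    case 4
    have "(U - q) * ((U - d) / (U - c)) < (U - p) * ((U - d) / (U - c))"
      using assms pq by (intro mult_strict_right_mono) auto
    then show ?thesis using 4 assms pq by (auto simp: bump_def)
  qed
qed

lemma bump_bounded_auts:
  assumes "L < c" "c < U" "L < d" "d < U"
  shows "bump L c d U \<in> bounded_auts"
proof -
  have "surj (bump L c d U)"
    using bump_inverse[of L d U c] assms by (metis surj_def)
  moreover have "\<forall>q. bump L c d U q \<noteq> q \<longrightarrow> L < q \<and> q < U"
    by (auto simp: bump_def)
  ultimately show ?thesis
    using bump_strict_mono[OF assms] unfolding bounded_auts_def by blast
qed

lemma bump_apply: "L < c \<Longrightarrow> c < U \<Longrightarrow> bump L c d U c = d"
  by (simp add: bump_def)

text \<open>
  One bump pushes \<open>y\<close> far up and fixes \<open>x\<close>; a second one pushes \<open>x\<close> far down and fixes the image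
  of \<open>y\<close>.
\<close>

lemma bounded_auts_stretch:
  fixes x y a b :: rat
  assumes "x < y"
  obtains h where "h \<in> bounded_auts" "h x \<le> a" "b \<le> h y"
proof -
  define b' where "b' = max b y + 1"
  define a' where "a' = min a x - 1"
  have *: "x < y" "y < b' + 1" "x < b'" "a' - 1 < x" "x < b'" "a' - 1 < a'" "a' < b'" "a' \<le> a" "b \<le> b'"
    using assms by (auto simp: b'_def a'_def)
  define h where "h = bump (a' - 1) x a' b' \<circ> bump x y b' (b' + 1)"
  have "h \<in> bounded_auts"
    unfolding h_def using * by (intro comp_bounded_auts bump_bounded_auts) auto
  moreover have "bump x y b' (b' + 1) x = x" "bump (a' - 1) x a' b' b' = b'"
    by (simp_all add: bump_def)
  then have "h x = a'" "h y = b'"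
    unfolding h_def using * bump_apply[of x y "b' + 1" b'] bump_apply[of "a' - 1" x b' a'] by simp_all
  ultimately show thesis using that * by metis
qed

text \<open>
  This is the strong form of simplicity. The map \<open>\<bar>g\<bar> = g \<squnion> g\<^sup>-\<^sup>1\<close> moves some point \<open>x\<close> up to \<open>y > x\<close>.
  Let \<open>h\<close> stretch the interval from \<open>x\<close> to \<open>y\<close> over one that contains the support of \<open>f\<close>. Then the
  conjugate of \<open>\<bar>g\<bar>\<close> by \<open>h\<close> carries every point of the support at least to the right end of that
  interval, whereas \<open>f\<close> and its inverse keep these points inside it; outside the support the conjugate
  is still at least the identity.
\<close>

lemma conjugate_dominates:
  assumes f: "f \<in> bounded_auts" and g: "g \<in> bounded_auts" and "g \<noteq> id"
  obtains h where "h \<in> bounded_auts"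
    "f \<le> h \<circ> sup g (aut_inv g) \<circ> aut_inv h" "aut_inv f \<le> h \<circ> sup g (aut_inv g) \<circ> aut_inv h"
proof -
  define G where "G = sup g (aut_inv g)"
  have G: "G \<in> bounded_auts" unfolding G_def by (intro sup_bounded_auts inv_bounded_auts g)
  have G_ge: "q \<le> G q" for q
  proof (cases "q \<le> g q")
    case False
    then show ?thesis using bounded_auts_mono[OF g, of q "aut_inv g q"] g
      by (simp add: G_def sup_max le_max_iff_disj)
  qed (simp add: G_def sup_max le_max_iff_disj)
  obtain x where x: "g x \<noteq> x" using \<open>g \<noteq> id\<close> by (metis eq_id_iff)
  have "G x \<noteq> x"
  proof
    assume *: "G x = x"
    then have "g x \<le> x" "aut_inv g x \<le> x"
      unfolding G_def by (metis sup_fun_def sup_ge1, metis sup_fun_def sup_ge2)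
    then show False
      using x bounded_auts_mono[OF g, of "aut_inv g x" x] g by simp
  qed
  with G_ge[of x] have "x < G x" by simp
  obtain a b where ab: "\<And>q. f q \<noteq> q \<Longrightarrow> a < q \<and> q < b"
    using f unfolding bounded_auts_def by blast
  obtain h where h: "h \<in> bounded_auts" "h x \<le> a" "b \<le> h (G x)"
    using bounded_auts_stretch[OF \<open>x < G x\<close>] by blast
  have dom: "k \<le> h \<circ> G \<circ> aut_inv h"
    if k: "k \<in> bounded_auts" and supp: "\<And>q. k q \<noteq> q \<Longrightarrow> a < q \<and> q < b" for k
  proof (rule le_funI)
    fix q
    show "k q \<le> (h \<circ> G \<circ> aut_inv h) q"
    proof (cases "k q = q")
      case True
      have "h (aut_inv h q) \<le> h (G (aut_inv h q))"
        using G_ge bounded_auts_mono[OF h(1)] by blast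
      then show ?thesis using True h(1) by simp
    next
      case False
      with supp have q: "a < q" "q < b" by auto
      have "k b = b" using supp[of b] by auto
      then have "k q \<le> b" using bounded_auts_mono[OF k, of q b] q by simp
      also have "b \<le> h (G x)" by (rule h(3))
      also have "\<dots> \<le> h (G (aut_inv h q))"
      proof -
        have "h x \<le> h (aut_inv h q)" using q h by simp
        then show ?thesis using bounded_auts_mono h(1) G by blast
      qed
      finally show ?thesis by simp
    qed
  qed
  have "aut_inv f q \<noteq> q \<Longrightarrow> a < q \<and> q < b" for q
    using ab[of q] bounded_auts_inv_apply[OF f] by metis
  with dom[OF f ab] dom[OF inv_bounded_auts[OF f]] show thesis
    using that[OF h(1)] unfolding G_def by blast
qed

section \<open>Transition maps between powers of the automorphism group\<close>

text \<open>
  An order isomorphism from the rationals onto the open unit interval.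
\<close>

definition unit_embedding :: "rat \<Rightarrow> rat"
  where "unit_embedding q = (1 + q / (1 + \<bar>q\<bar>)) / 2"

lemma strict_mono_unit_embedding: "strict_mono unit_embedding"
proof (rule strict_monoI)
  fix p q :: rat
  assume pq: "p < q"
  have p: "0 < 1 + \<bar>p\<bar>" and q: "0 < 1 + \<bar>q\<bar>" by linarith+
  have "p * (1 + \<bar>q\<bar>) < q * (1 + \<bar>p\<bar>)"
  proof (cases "0 \<le> p \<or> q \<le> 0")
    case True
    then have "p * \<bar>q\<bar> = q * \<bar>p\<bar>" using pq by (auto simp: abs_if)
    then show ?thesis using pq by (simp add: algebra_simps)
  next
    case False
    then have "p * (1 + \<bar>q\<bar>) < 0" "0 < q * (1 + \<bar>p\<bar>)"
      using p q by (auto intro: mult_neg_pos)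
    then show ?thesis by linarith
  qed
  then have "p / (1 + \<bar>p\<bar>) < q / (1 + \<bar>q\<bar>)"
    using p q by (simp add: divide_simps)
  then show "unit_embedding p < unit_embedding q"
    unfolding unit_embedding_def by (intro divide_strict_right_mono add_strict_left_mono) simp_all
qed

lemma range_unit_embedding: "range unit_embedding = {0<..<1}"
proof (intro equalityI subsetI)
  fix y
  assume "y \<in> range unit_embedding"
  then obtain q where y: "y = unit_embedding q" by blast
  have "0 < 1 + \<bar>q\<bar>" by linarith
  then have "-1 < q / (1 + \<bar>q\<bar>)" "q / (1 + \<bar>q\<bar>) < 1"
    by (auto simp: field_simps)
  then show "y \<in> {0<..<1}" by (simp add: y unit_embedding_def)
next
  fix y :: rat
  assume y: "y \<in> {0<..<1}"
  define t where "t = 2 * y - 1"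
  have t: "0 < 1 - \<bar>t\<bar>" using y by (auto simp: t_def abs_if)
  have "1 + \<bar>t / (1 - \<bar>t\<bar>)\<bar> = 1 / (1 - \<bar>t\<bar>)"
    using t by (simp add: field_simps)
  then have "unit_embedding (t / (1 - \<bar>t\<bar>)) = y"
    using t by (simp add: unit_embedding_def t_def)
  then show "y \<in> range unit_embedding" by (metis rangeI)
qed

lemma unit_embedding_bounds: "0 < unit_embedding q" "unit_embedding q < 1"
proof -
  have "unit_embedding q \<in> {0<..<1}"
    unfolding range_unit_embedding[symmetric] by blast
  then show "0 < unit_embedding q" "unit_embedding q < 1" by simp_all
qed

text \<open>
  The map \<open>piece v\<close> embeds the \<open>v\<close>-th copy of the rationals. The inner embedding makes the images
  disjoint by placing them into different unit intervals; the outer one brings all of them into the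
  open unit interval, so that a map acting on any number of copies has bounded support.
\<close>

definition piece :: "nat \<Rightarrow> rat \<Rightarrow> rat"
  where "piece v q = unit_embedding (of_nat v + unit_embedding q)"

lemma piece_less [simp]: "piece v p < piece v q \<longleftrightarrow> p < q"
  by (simp add: piece_def strict_mono_less[OF strict_mono_unit_embedding])

lemma piece_le [simp]: "piece v p \<le> piece v q \<longleftrightarrow> p \<le> q"
  by (simp add: piece_def strict_mono_less_eq[OF strict_mono_unit_embedding])

lemma piece_eq [simp]: "piece u p = piece v q \<longleftrightarrow> u = v \<and> p = q"
proof
  assume "piece u p = piece v q"
  then have *: "of_nat u + unit_embedding p = of_nat v + unit_embedding q"
    by (simp add: piece_def strict_mono_eq[OF strict_mono_unit_embedding])
  have "\<lfloor>of_nat w + unit_embedding r\<rfloor> = int w" for w r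
    using unit_embedding_bounds[of r] by (intro floor_unique) auto
  with * have "u = v" by (metis of_nat_eq_iff)
  then show "u = v \<and> p = q" using * by (simp add: strict_mono_eq[OF strict_mono_unit_embedding])
qed simp

lemma piece_convex:
  assumes "piece v p < x" "x < piece v q"
  shows "x \<in> range (piece v)"
proof -
  have "0 < x" using assms(1) unit_embedding_bounds(1) unfolding piece_def by (rule less_trans[rotated])
  moreover have "x < 1" using assms(2) unit_embedding_bounds(2) unfolding piece_def by (rule less_trans)
  ultimately have "x \<in> range unit_embedding" unfolding range_unit_embedding by simp
  then obtain y where y: "x = unit_embedding y" by blast
  then have "of_nat v + unit_embedding p < y" "y < of_nat v + unit_embedding q"
    using assms by (simp_all add: piece_def strict_mono_less[OF strict_mono_unit_embedding])
  then have "y - of_nat v \<in> {0<..<1}"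
    using unit_embedding_bounds(1)[of p] unit_embedding_bounds(2)[of q] by auto
  then obtain z where "y - of_nat v = unit_embedding z" unfolding range_unit_embedding[symmetric] by blast
  then have "x = piece v z"
    by (simp add: y piece_def flip: \<open>y - of_nat v = unit_embedding z\<close>)
  then show ?thesis by blast
qed

lemma piece_below: "piece v p < x \<Longrightarrow> x \<notin> range (piece v) \<Longrightarrow> piece v q < x"
  using piece_convex[of v p x q] by (cases x "piece v q" rule: linorder_cases) auto

lemma piece_above: "x < piece v p \<Longrightarrow> x \<notin> range (piece v) \<Longrightarrow> x < piece v q"
  using piece_convex[of v q x p] by (cases x "piece v q" rule: linorder_cases) auto

text \<open>
  In coordinate \<open>w\<close>, the map \<open>f v\<close> acts on the \<open>v\<close>-th copy for each parent \<open>v\<close> of \<open>w\<close>, and all other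
  points are fixed. As the copies are disjoint, the description determines the value.
\<close>

definition lift :: "(nat \<Rightarrow> nat set) \<Rightarrow> (nat \<Rightarrow> rat \<Rightarrow> rat) \<Rightarrow> nat \<Rightarrow> rat \<Rightarrow> rat"
  where "lift E f w x =
    (if \<exists>v q. w \<in> E v \<and> x = piece v q then THE y. \<exists>v q. x = piece v q \<and> y = piece v (f v q) else x)"

lemma lift_piece [simp]: "w \<in> E v \<Longrightarrow> lift E f w (piece v q) = piece v (f v q)"
  unfolding lift_def by (auto intro!: the_equality)

lemma lift_outside: "(\<And>v. w \<in> E v \<Longrightarrow> x \<notin> range (piece v)) \<Longrightarrow> lift E f w x = x"
  unfolding lift_def by auto

lemma lift_cases [case_names inside outside]:
  obtains v q where "w \<in> E v" "x = piece v q" | "\<And>v. w \<in> E v \<Longrightarrow> x \<notin> range (piece v)"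
  by blast

lemma lift_id: "lift E (\<lambda>v. id) w = id"
proof
  show "lift E (\<lambda>v. id) w x = id x" for x
    by (cases rule: lift_cases[of w E x]) (simp_all add: lift_outside)
qed

lemma lift_comp: "lift E (\<lambda>v. f v \<circ> g v) w = lift E f w \<circ> lift E g w"
proof
  show "lift E (\<lambda>v. f v \<circ> g v) w x = (lift E f w \<circ> lift E g w) x" for x
    by (cases rule: lift_cases[of w E x]) (simp_all add: lift_outside)
qed

lemma lift_sup: "lift E (sup f g) w = sup (lift E f w) (lift E g w)"
proof
  show "lift E (sup f g) w x = sup (lift E f w) (lift E g w) x" for x
    by (cases rule: lift_cases[of w E x]) (simp_all add: lift_outside sup_max max_def)
qed

lemma lift_inf: "lift E (inf f g) w = inf (lift E f w) (lift E g w)"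
proof
  show "lift E (inf f g) w x = inf (lift E f w) (lift E g w) x" for x
    by (cases rule: lift_cases[of w E x]) (simp_all add: lift_outside inf_min min_def)
qed

lemma lift_mono: "f \<le> g \<Longrightarrow> lift E f \<le> lift E g"
proof (intro le_funI)
  show "f \<le> g \<Longrightarrow> lift E f w x \<le> lift E g w x" for w x
    by (cases rule: lift_cases[of w E x]) (simp_all add: lift_outside le_fun_def)
qed

text \<open>
  On supports, the lift is the join homomorphism given by \<open>E\<close>.
\<close>

lemma lift_eq_id_iff: "lift E f w = id \<longleftrightarrow> (\<forall>v. w \<in> E v \<longrightarrow> f v = id)"
proof
  assume *: "lift E f w = id"
  show "\<forall>v. w \<in> E v \<longrightarrow> f v = id"
  proof (intro allI impI ext)
    fix v q
    assume "w \<in> E v"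
    then have "piece v (f v q) = piece v q" using * by (metis id_apply lift_piece)
    then show "f v q = id q" by simp
  qed
next
  assume *: "\<forall>v. w \<in> E v \<longrightarrow> f v = id"
  show "lift E f w = id"
  proof
    show "lift E f w x = id x" for x
      using * by (cases rule: lift_cases[of w E x]) (simp_all add: lift_outside)
  qed
qed

text \<open>
  The copies are convex, so each of them lies on one side of any point outside it. Hence moving
  points inside their copies does not change the order between points of different copies.
\<close>

lemma lift_strict_mono:
  assumes f: "\<And>v. strict_mono (f v)"
  shows "strict_mono (lift E f w)"
proof (rule strict_monoI)
  fix x y :: rat
  assume xy: "x < y"
  show "lift E f w x < lift E f w y"
  proof (cases rule: lift_cases[of w E x])
    case x: (inside v p)
    show ?thesis
    proof (cases rule: lift_cases[of w E y])
      case y: (inside u q)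
      show ?thesis
      proof (cases "u = v")
        case True
        then show ?thesis using x y xy f by (simp add: strict_mono_less)
      next
        case False
        then have notin: "piece u r \<notin> range (piece v)" "piece v r \<notin> range (piece u)" for r by auto
        have "piece v (f v p) < piece u q"
          using xy notin(1) unfolding x(2) y(2) by (rule piece_below)
        then have "piece v (f v p) < piece u (f u q)"
          using notin(2) by (rule piece_above)
        then show ?thesis using x y by simp
      qed
    next
      case outside
      have "piece v (f v p) < y" using xy outside[OF x(1)] unfolding x(2) by (rule piece_below)
      then show ?thesis using x lift_outside[of w E y f, OF outside] by simp
    qed
  next
    case x: outside
    show ?thesis
    proof (cases rule: lift_cases[of w E y])
      case (inside u q)
      have "x < piece u (f u q)" using xy x[OF inside(1)] unfolding inside(2) by (rule piece_above)
      then show ?thesis using inside lift_outside[of w E x f, OF x] by simp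
    next
      case outside
      then show ?thesis
        using xy lift_outside[of w E x f, OF x] lift_outside[of w E y f, OF outside] by simp
    qed
  qed
qed

lemma lift_bounded_auts:
  assumes f: "\<And>v. f v \<in> bounded_auts"
  shows "lift E f w \<in> bounded_auts"
proof -
  have inverse: "lift E f w \<circ> lift E (\<lambda>v. aut_inv (f v)) w = id"
  proof -
    have "f v \<circ> aut_inv (f v) = id" for v using f[of v] by auto
    then show ?thesis unfolding lift_comp[symmetric] by (simp add: lift_id)
  qed
  have "surj (lift E f w)" using inverse by (metis comp_apply id_apply surj_def)
  moreover have "strict_mono (lift E f w)"
    using f by (intro lift_strict_mono) (auto simp: bounded_auts_def)
  moreover have "0 < x \<and> x < 1" if "lift E f w x \<noteq> x" for x
  proof (cases rule: lift_cases[of w E x])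
    case (inside v q)
    then show ?thesis by (simp add: piece_def unit_embedding_bounds)
  next
    case outside
    then show ?thesis using that lift_outside[of w E x f, OF outside] by simp
  qed
  ultimately show ?thesis unfolding bounded_auts_def by blast
qed

lemma lift_inv:
  assumes f: "\<And>v. f v \<in> bounded_auts"
  shows "lift E (\<lambda>v. aut_inv (f v)) w = aut_inv (lift E f w)"
proof (rule sym, rule inv_unique_comp)
  have "f v \<circ> aut_inv (f v) = id" "aut_inv (f v) \<circ> f v = id" for v using f[of v] by auto
  then show "lift E f w \<circ> lift E (\<lambda>v. aut_inv (f v)) w = id" "lift E (\<lambda>v. aut_inv (f v)) w \<circ> lift E f w = id"
    unfolding lift_comp[symmetric] by (simp_all add: lift_id)
qed

definition supp :: "(nat \<Rightarrow> rat \<Rightarrow> rat) \<Rightarrow> nat set"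
  where "supp g = {v. g v \<noteq> id}"

lemma supp_lift: "supp (lift E f) = (\<Union>v\<in>supp f. E v)"
  unfolding supp_def using lift_eq_id_iff[of E f] by auto

section \<open>Finitely generated ideals described by a valuation\<close>

context l_group
begin

lemma generators_subset: "A \<subseteq> l_ideal_generated G A"
  unfolding l_ideal_generated_def by blast

lemma one_mem_l_ideal_generated:
  assumes "A \<subseteq> carrier G"
  shows "\<one> \<in> l_ideal_generated G A"
proof -
  interpret l_ideal "l_ideal_generated G A" G by (rule l_ideal_l_ideal_generated[OF assms])
  show ?thesis by (rule one_closed)
qed

lemma l_ideal_generated_mono:
  assumes "A \<subseteq> carrier G" "B \<subseteq> l_ideal_generated G A"
  shows "l_ideal_generated G B \<subseteq> l_ideal_generated G A"
  using assms(2) l_ideal_l_ideal_generated[OF assms(1)]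
  unfolding l_ideal_generated_def[of G B] by blast

lemma l_ideal_generated_closed: "A \<subseteq> carrier G \<Longrightarrow> l_ideal_generated G A \<subseteq> carrier G"
  using l_ideal_carrier unfolding l_ideal_generated_def by blast

text \<open>
  A valuation \<open>\<nu>\<close> with values in a semilattice identifies the latter with the finitely generated
  \<open>l\<close>-ideals as soon as the elements of value at most \<open>s\<close> form an \<open>l\<close>-ideal, values decide membership in
  principal \<open>l\<close>-ideals, and the \<open>l\<close>-ideal generated by two elements has a member whose value bounds both
  of theirs. By the last condition every finitely generated \<open>l\<close>-ideal is principal, and the principal
  one generated by \<open>g\<close> consists of the elements of value at most \<open>\<nu> g\<close>.
\<close>

lemma semilattice_zero_iso_fg_l_ideals:
  fixes S :: "('c, 'd) gorder_scheme"
  assumes S: "semilattice_zero S"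
    and ideal: "\<And>s. s \<in> carrier S \<Longrightarrow> l_ideal {g \<in> carrier G. \<nu> g \<sqsubseteq>\<^bsub>S\<^esub> s} G"
    and surj: "\<nu> ` carrier G = carrier S"
    and gen: "\<And>f g. f \<in> carrier G \<Longrightarrow> g \<in> carrier G \<Longrightarrow> \<nu> f \<sqsubseteq>\<^bsub>S\<^esub> \<nu> g \<Longrightarrow>
      f \<in> l_ideal_generated G {g}"
    and bound: "\<And>f g. f \<in> carrier G \<Longrightarrow> g \<in> carrier G \<Longrightarrow>
      \<exists>h \<in> l_ideal_generated G {f, g}. \<nu> f \<sqsubseteq>\<^bsub>S\<^esub> \<nu> h \<and> \<nu> g \<sqsubseteq>\<^bsub>S\<^esub> \<nu> h"
  shows "(\<lambda>s. {g \<in> carrier G. \<nu> g \<sqsubseteq>\<^bsub>S\<^esub> s}) \<in> semilattice_zero_iso S (fg_l_ideals G)"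
proof -
  interpret S: semilattice_zero S by (rule S)
  define I where "I s = {g \<in> carrier G. \<nu> g \<sqsubseteq>\<^bsub>S\<^esub> s}" for s
  have \<nu>: "\<nu> g \<in> carrier S" if "g \<in> carrier G" for g
    unfolding surj[symmetric] using that by (rule imageI)
  have obtain_\<nu>: "\<exists>g\<in>carrier G. \<nu> g = s" if "s \<in> carrier S" for s
    using that unfolding surj[symmetric] by (rule imageE) (intro bexI, rule sym)
  have I_least: "l_ideal_generated G A \<subseteq> I s" if "s \<in> carrier S" "A \<subseteq> I s" for A s
    unfolding l_ideal_generated_def using ideal[OF that(1)] that(2)
    by (intro Inter_lower) (simp add: I_def)
  have principal: "l_ideal_generated G {g} = I (\<nu> g)" if g: "g \<in> carrier G" for g
  proof
    show "l_ideal_generated G {g} \<subseteq> I (\<nu> g)"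
      using g \<nu>[OF g] by (intro I_least) (simp_all add: I_def)
    show "I (\<nu> g) \<subseteq> l_ideal_generated G {g}"
    proof
      fix f
      assume "f \<in> I (\<nu> g)"
      then have "f \<in> carrier G" "\<nu> f \<sqsubseteq>\<^bsub>S\<^esub> \<nu> g" unfolding I_def by simp_all
      then show "f \<in> l_ideal_generated G {g}" by (rule gen[OF _ g])
    qed
  qed
  have one: "l_ideal_generated G {} = l_ideal_generated G {\<one>}"
  proof
    show "l_ideal_generated G {} \<subseteq> l_ideal_generated G {\<one>}"
      by (rule l_ideal_generated_mono) simp_all
    show "l_ideal_generated G {\<one>} \<subseteq> l_ideal_generated G {}"
      using one_mem_l_ideal_generated[of "{}"] by (intro l_ideal_generated_mono) simp_all
  qed
  have join_principal: "\<exists>k\<in>carrier G. \<nu> f \<sqsubseteq>\<^bsub>S\<^esub> \<nu> k \<and> \<nu> g \<sqsubseteq>\<^bsub>S\<^esub> \<nu> k \<and>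
      l_ideal_generated G {f, g} = l_ideal_generated G {k}"
    if fg: "f \<in> carrier G" "g \<in> carrier G" for f g
  proof -
    obtain k where k: "k \<in> l_ideal_generated G {f, g}" "\<nu> f \<sqsubseteq>\<^bsub>S\<^esub> \<nu> k" "\<nu> g \<sqsubseteq>\<^bsub>S\<^esub> \<nu> k"
      using bound[OF fg] by (elim bexE conjE)
    have kG: "k \<in> carrier G" using k(1) l_ideal_generated_closed[of "{f, g}"] fg by blast
    have "l_ideal_generated G {f, g} \<subseteq> l_ideal_generated G {k}"
      using gen[OF fg(1) kG k(2)] gen[OF fg(2) kG k(3)] kG by (intro l_ideal_generated_mono) simp_all
    moreover have "l_ideal_generated G {k} \<subseteq> l_ideal_generated G {f, g}"
      using k(1) fg by (intro l_ideal_generated_mono) simp_all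
    ultimately show ?thesis using k kG by (intro bexI[of _ k]) simp_all
  qed
  have fg_principal: "\<exists>h\<in>carrier G. l_ideal_generated G A = l_ideal_generated G {h}"
    if "finite A" "A \<subseteq> carrier G" for A
    using that
  proof (induction A)
    case empty
    then show ?case using one by (intro bexI[of _ \<one>]) simp_all
  next
    case (insert a A)
    then have "\<exists>h\<in>carrier G. l_ideal_generated G A = l_ideal_generated G {h}" by simp
    then obtain h where h: "h \<in> carrier G" "l_ideal_generated G A = l_ideal_generated G {h}"
      by (elim bexE)
    have a: "a \<in> carrier G" and A: "A \<subseteq> carrier G" using insert.prems by simp_all
    obtain k where k: "k \<in> carrier G" "l_ideal_generated G {a, h} = l_ideal_generated G {k}"
      using join_principal[OF a h(1)] by (elim bexE conjE)
    have ahG: "{a, h} \<subseteq> carrier G" using a h by simp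
    have ah: "a \<in> l_ideal_generated G {a, h}" "h \<in> l_ideal_generated G {a, h}"
      using generators_subset[of "{a, h}"] by simp_all
    have "{h} \<subseteq> l_ideal_generated G {a, h}" using ah(2) by simp
    from l_ideal_generated_mono[OF ahG this]
    have "A \<subseteq> l_ideal_generated G {a, h}"
      unfolding h(2)[symmetric] by (rule subset_trans[OF generators_subset])
    then have "l_ideal_generated G (insert a A) \<subseteq> l_ideal_generated G {a, h}"
      using ah(1) by (intro l_ideal_generated_mono ahG) simp
    moreover have "A \<subseteq> l_ideal_generated G (insert a A)"
      by (rule subset_trans[OF subset_insertI generators_subset])
    from l_ideal_generated_mono[OF insert.prems this]
    have "{h} \<subseteq> l_ideal_generated G (insert a A)"
      unfolding h(2) by (rule subset_trans[OF generators_subset])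
    then have "l_ideal_generated G {a, h} \<subseteq> l_ideal_generated G (insert a A)"
      using generators_subset[of "insert a A"] insert.prems by (intro l_ideal_generated_mono) simp_all
    ultimately show ?case using k by (intro bexI[of _ k]) simp_all
  qed
  have inj: "inj_on I (carrier S)"
  proof (rule inj_onI)
    fix s t
    assume st: "s \<in> carrier S" "t \<in> carrier S" "I s = I t"
    have le: "s \<sqsubseteq>\<^bsub>S\<^esub> t" if s: "s \<in> carrier S" and sub: "I s \<subseteq> I t" for s t
    proof -
      obtain g where g: "g \<in> carrier G" "\<nu> g = s" using obtain_\<nu>[OF s] by (elim bexE)
      then have "g \<in> I s" using s unfolding I_def by simp
      with sub have "g \<in> I t" by (rule subsetD)
      then show ?thesis using g(2) unfolding I_def by simp
    qed
    show "s = t" using le[of s t] le[of t s] st by (intro S.le_antisym) simp_all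
  qed
  have onto: "I ` carrier S = carrier (fg_l_ideals G)"
  proof (intro equalityI subsetI)
    fix J
    assume "J \<in> I ` carrier S"
    then obtain s where s: "s \<in> carrier S" "J = I s" by (elim imageE)
    obtain g where "g \<in> carrier G" "\<nu> g = s" using obtain_\<nu>[OF s(1)] by (elim bexE)
    with s(2) have g: "g \<in> carrier G" "J = I (\<nu> g)" by simp_all
    have "J = l_ideal_generated G {g}" unfolding g(2) by (rule principal[OF g(1), symmetric])
    then show "J \<in> carrier (fg_l_ideals G)"
      using g(1) unfolding fg_l_ideals_def by (simp, intro exI[of _ "{g}"]) simp
  next
    fix J
    assume "J \<in> carrier (fg_l_ideals G)"
    then obtain A where A: "finite A" "A \<subseteq> carrier G" "J = l_ideal_generated G A"
      unfolding fg_l_ideals_def by auto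
    obtain h where h: "h \<in> carrier G" "J = l_ideal_generated G {h}"
      using fg_principal[OF A(1,2)] unfolding A(3) by (elim bexE)
    then have "J = I (\<nu> h)" by (simp only: principal)
    then show "J \<in> I ` carrier S" using \<nu>[OF h(1)] by (rule image_eqI)
  qed
  have bot: "I \<bottom>\<^bsub>S\<^esub> = \<bottom>\<^bsub>fg_l_ideals G\<^esub>"
  proof -
    have "I \<bottom>\<^bsub>S\<^esub> \<subseteq> I (\<nu> \<one>)"
    proof
      fix x
      assume "x \<in> I \<bottom>\<^bsub>S\<^esub>"
      then have x: "x \<in> carrier G" "\<nu> x \<sqsubseteq>\<^bsub>S\<^esub> \<bottom>\<^bsub>S\<^esub>" unfolding I_def by simp_all
      have "\<nu> x \<sqsubseteq>\<^bsub>S\<^esub> \<nu> \<one>"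
        by (rule S.le_trans[OF x(2) S.bottom_lower]) (simp_all add: \<nu> x(1))
      then show "x \<in> I (\<nu> \<one>)" using x(1) unfolding I_def by simp
    qed
    moreover have "l_ideal_generated G {} \<subseteq> I \<bottom>\<^bsub>S\<^esub>" by (rule I_least) simp_all
    ultimately show ?thesis using principal[of \<one>] one unfolding fg_l_ideals_bottom by simp
  qed
  have join: "I (s \<squnion>\<^bsub>S\<^esub> t) = I s \<squnion>\<^bsub>fg_l_ideals G\<^esub> I t" if st: "s \<in> carrier S" "t \<in> carrier S" for s t
  proof -
    obtain f where f: "f \<in> carrier G" "\<nu> f = s" using obtain_\<nu>[OF st(1)] by (elim bexE)
    obtain g where g: "g \<in> carrier G" "\<nu> g = t" using obtain_\<nu>[OF st(2)] by (elim bexE)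
    obtain k where k: "k \<in> carrier G" "s \<sqsubseteq>\<^bsub>S\<^esub> \<nu> k" "t \<sqsubseteq>\<^bsub>S\<^esub> \<nu> k"
      "l_ideal_generated G {f, g} = l_ideal_generated G {k}"
      using join_principal[OF f(1) g(1)] unfolding f g by (elim bexE conjE)
    have stS: "s \<squnion>\<^bsub>S\<^esub> t \<in> carrier S" using st by simp
    have le: "s \<squnion>\<^bsub>S\<^esub> t \<sqsubseteq>\<^bsub>S\<^esub> \<nu> k" by (rule S.join_le[OF k(2,3) st \<nu>[OF k(1)]])
    have "I (s \<squnion>\<^bsub>S\<^esub> t) \<subseteq> I (\<nu> k)"
    proof
      fix x
      assume "x \<in> I (s \<squnion>\<^bsub>S\<^esub> t)"
      then have x: "x \<in> carrier G" "\<nu> x \<sqsubseteq>\<^bsub>S\<^esub> s \<squnion>\<^bsub>S\<^esub> t" unfolding I_def by simp_all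
      have "\<nu> x \<sqsubseteq>\<^bsub>S\<^esub> \<nu> k" by (rule S.le_trans[OF x(2) le \<nu>[OF x(1)] stS \<nu>[OF k(1)]])
      then show "x \<in> I (\<nu> k)" using x(1) unfolding I_def by simp
    qed
    moreover have "l_ideal_generated G {f, g} \<subseteq> I (s \<squnion>\<^bsub>S\<^esub> t)"
      using f g st S.join_left[OF st] S.join_right[OF st] by (intro I_least stS) (simp add: I_def)
    ultimately have "I (s \<squnion>\<^bsub>S\<^esub> t) = l_ideal_generated G ({f} \<union> {g})"
      using principal[OF k(1)] k(4) by (simp add: insert_commute)
    also have "\<dots> = l_ideal_generated G {f} \<squnion>\<^bsub>fg_l_ideals G\<^esub> l_ideal_generated G {g}"
      using f g by (intro fg_l_ideals_join[symmetric]) simp_all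
    finally show ?thesis using principal[OF f(1)] principal[OF g(1)] f g by simp
  qed
  have "I \<in> semilattice_zero_iso S (fg_l_ideals G)"
    unfolding semilattice_zero_iso_def bij_betw_def using inj onto bot join by simp
  then show ?thesis unfolding I_def[abs_def] .
qed

end

section \<open>Lattice-ordered groups from preordered groups\<close>

text \<open>
  A direct limit is most easily described by representatives on which the group operations are exact
  but the order is only a preorder. The map \<open>c\<close> names the classes of equivalent representatives;
  it allows the carrier of the resulting \<open>l\<close>-group to consist of elements of any sufficiently large type.
\<close>

locale l_group_presentation =
  fixes K :: "'k set" and mul :: "'k \<Rightarrow> 'k \<Rightarrow> 'k" and e :: 'k and iv :: "'k \<Rightarrow> 'k"
    and le :: "'k \<Rightarrow> 'k \<Rightarrow> bool" and sp ip :: "'k \<Rightarrow> 'k \<Rightarrow> 'k" and c :: "'k \<Rightarrow> 'g"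
  assumes mul_closed: "x \<in> K \<Longrightarrow> y \<in> K \<Longrightarrow> mul x y \<in> K"
    and e_closed: "e \<in> K"
    and iv_closed: "x \<in> K \<Longrightarrow> iv x \<in> K"
    and assoc: "x \<in> K \<Longrightarrow> y \<in> K \<Longrightarrow> z \<in> K \<Longrightarrow> mul (mul x y) z = mul x (mul y z)"
    and left_one: "x \<in> K \<Longrightarrow> mul e x = x"
    and left_inv: "x \<in> K \<Longrightarrow> mul (iv x) x = e"
    and refl: "x \<in> K \<Longrightarrow> le x x"
    and trans: "le x y \<Longrightarrow> le y z \<Longrightarrow> x \<in> K \<Longrightarrow> y \<in> K \<Longrightarrow> z \<in> K \<Longrightarrow> le x z"
    and mono: "le x y \<Longrightarrow> le z w \<Longrightarrow> x \<in> K \<Longrightarrow> y \<in> K \<Longrightarrow> z \<in> K \<Longrightarrow> w \<in> K \<Longrightarrow> le (mul x z) (mul y w)"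
    and sp_closed: "x \<in> K \<Longrightarrow> y \<in> K \<Longrightarrow> sp x y \<in> K"
    and sp_le_iff: "x \<in> K \<Longrightarrow> y \<in> K \<Longrightarrow> z \<in> K \<Longrightarrow> le (sp x y) z \<longleftrightarrow> le x z \<and> le y z"
    and ip_closed: "x \<in> K \<Longrightarrow> y \<in> K \<Longrightarrow> ip x y \<in> K"
    and le_ip_iff: "x \<in> K \<Longrightarrow> y \<in> K \<Longrightarrow> z \<in> K \<Longrightarrow> le z (ip x y) \<longleftrightarrow> le z x \<and> le z y"
    and c_eq_iff: "x \<in> K \<Longrightarrow> y \<in> K \<Longrightarrow> c x = c y \<longleftrightarrow> le x y \<and> le y x"
begin

definition rep :: "'g \<Rightarrow> 'k" where "rep = inv_into K c"

definition presented :: "'g ordered_monoid"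
  where "presented = \<lparr>carrier = c ` K, monoid.mult = \<lambda>a b. c (mul (rep a) (rep b)), one = c e,
    ole = \<lambda>a b. le (rep a) (rep b)\<rparr>"

lemma carrier_presented: "carrier presented = c ` K"
  by (simp add: presented_def)

lemma one_presented: "\<one>\<^bsub>presented\<^esub> = c e"
  by (simp add: presented_def)

lemma rep:
  assumes "x \<in> K"
  shows "rep (c x) \<in> K" "le (rep (c x)) x" "le x (rep (c x))"
proof -
  have "c x \<in> c ` K" using assms by (rule imageI)
  then show "rep (c x) \<in> K" unfolding rep_def by (rule inv_into_into)
  moreover have "c (rep (c x)) = c x" unfolding rep_def using \<open>c x \<in> c ` K\<close> by (rule f_inv_into_f)
  ultimately show "le (rep (c x)) x" "le x (rep (c x))" using c_eq_iff assms by blast+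
qed

lemma mult_presented:
  assumes "x \<in> K" "y \<in> K"
  shows "c x \<otimes>\<^bsub>presented\<^esub> c y = c (mul x y)"
  using assms rep[OF assms(1)] rep[OF assms(2)]
  by (simp add: presented_def c_eq_iff mul_closed mono)

lemma ole_presented:
  assumes "x \<in> K" "y \<in> K"
  shows "ole presented (c x) (c y) \<longleftrightarrow> le x y"
proof -
  note x = rep[OF assms(1)] and y = rep[OF assms(2)]
  have "le (rep (c x)) (rep (c y)) \<longleftrightarrow> le x y"
  proof
    assume *: "le (rep (c x)) (rep (c y))"
    have "le x (rep (c y))" by (rule trans[OF x(3) * assms(1) x(1) y(1)])
    from trans[OF this y(2) assms(1) y(1) assms(2)] show "le x y" .
  next
    assume *: "le x y"
    have "le (rep (c x)) y" by (rule trans[OF x(2) * x(1) assms])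
    from trans[OF this y(3) x(1) assms(2) y(1)] show "le (rep (c x)) (rep (c y))" .
  qed
  then show ?thesis by (simp add: presented_def)
qed

lemma group_presented: "group presented"
proof (rule groupI)
  show "\<one>\<^bsub>presented\<^esub> \<in> carrier presented" by (simp add: one_presented carrier_presented e_closed)
  fix a assume "a \<in> carrier presented"
  then obtain x where x: "x \<in> K" "a = c x" by (auto simp: carrier_presented)
  show "\<one>\<^bsub>presented\<^esub> \<otimes>\<^bsub>presented\<^esub> a = a" using x by (simp add: one_presented mult_presented e_closed left_one)
  have "c (iv x) \<otimes>\<^bsub>presented\<^esub> a = \<one>\<^bsub>presented\<^esub>"
    using x by (simp add: one_presented mult_presented iv_closed left_inv)
  then show "\<exists>b\<in>carrier presented. b \<otimes>\<^bsub>presented\<^esub> a = \<one>\<^bsub>presented\<^esub>"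
    using x iv_closed by (auto simp: carrier_presented)
  fix b assume "b \<in> carrier presented"
  then obtain y where y: "y \<in> K" "b = c y" by (auto simp: carrier_presented)
  show "a \<otimes>\<^bsub>presented\<^esub> b \<in> carrier presented" using x y by (simp add: mult_presented carrier_presented mul_closed)
  fix d assume "d \<in> carrier presented"
  then obtain z where z: "z \<in> K" "d = c z" by (auto simp: carrier_presented)
  show "(a \<otimes>\<^bsub>presented\<^esub> b) \<otimes>\<^bsub>presented\<^esub> d = a \<otimes>\<^bsub>presented\<^esub> (b \<otimes>\<^bsub>presented\<^esub> d)"
    using x y z by (simp add: mult_presented mul_closed assoc)
qed

lemma inv_presented:
  assumes "x \<in> K"
  shows "inv\<^bsub>presented\<^esub> (c x) = c (iv x)"
  using assms by (intro group.inv_equality[OF group_presented])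
    (simp_all add: one_presented mult_presented carrier_presented iv_closed left_inv)

lemma partial_order_presented: "partial_order (order_of presented)"
proof
  fix a b d
  assume "a \<in> carrier (order_of presented)" "b \<in> carrier (order_of presented)"
  then obtain x y where xy: "x \<in> K" "a = c x" "y \<in> K" "b = c y"
    by (auto simp: carrier_presented order_of_def)
  show "a .=\<^bsub>order_of presented\<^esub> b" if "a \<sqsubseteq>\<^bsub>order_of presented\<^esub> b" "b \<sqsubseteq>\<^bsub>order_of presented\<^esub> a"
    using xy that by (simp add: order_of_def ole_presented c_eq_iff)
  assume "d \<in> carrier (order_of presented)"
  then obtain z where z: "z \<in> K" "d = c z" by (auto simp: carrier_presented order_of_def)
  show "a \<sqsubseteq>\<^bsub>order_of presented\<^esub> d" if "a \<sqsubseteq>\<^bsub>order_of presented\<^esub> b" "b \<sqsubseteq>\<^bsub>order_of presented\<^esub> d"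
    using xy z that trans[of x y z] by (simp add: order_of_def ole_presented)
qed (auto simp: order_of_def carrier_presented ole_presented refl)

lemma least_sp:
  assumes "x \<in> K" "y \<in> K"
  shows "least (order_of presented) (c (sp x y)) (Upper (order_of presented) {c x, c y})"
proof (rule least_UpperI)
  have "le (sp x y) (sp x y)" using assms by (intro refl sp_closed)
  then have le: "le x (sp x y)" "le y (sp x y)"
    using sp_le_iff[of x y "sp x y"] sp_closed assms by simp_all
  show "{c x, c y} \<subseteq> carrier (order_of presented)" "c (sp x y) \<in> carrier (order_of presented)"
    using assms by (simp_all add: order_of_def carrier_presented sp_closed)
  show "a \<sqsubseteq>\<^bsub>order_of presented\<^esub> c (sp x y)" if "a \<in> {c x, c y}" for a
    using that le assms by (auto simp: order_of_def ole_presented sp_closed)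
  fix u assume u: "u \<in> Upper (order_of presented) {c x, c y}"
  then have "u \<in> c ` K" by (auto simp: Upper_def order_of_def carrier_presented)
  then obtain z where z: "z \<in> K" "u = c z" by blast
  have "le x z" "le y z" using u assms z
    by (auto simp: Upper_def order_of_def carrier_presented ole_presented)
  then show "c (sp x y) \<sqsubseteq>\<^bsub>order_of presented\<^esub> u"
    using assms z by (simp add: order_of_def ole_presented sp_closed sp_le_iff)
qed

lemma greatest_ip:
  assumes "x \<in> K" "y \<in> K"
  shows "greatest (order_of presented) (c (ip x y)) (Lower (order_of presented) {c x, c y})"
proof (rule greatest_LowerI)
  have "le (ip x y) (ip x y)" using assms by (intro refl ip_closed)
  then have le: "le (ip x y) x" "le (ip x y) y"
    using le_ip_iff[of x y "ip x y"] ip_closed assms by simp_all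
  show "{c x, c y} \<subseteq> carrier (order_of presented)" "c (ip x y) \<in> carrier (order_of presented)"
    using assms by (simp_all add: order_of_def carrier_presented ip_closed)
  show "c (ip x y) \<sqsubseteq>\<^bsub>order_of presented\<^esub> a" if "a \<in> {c x, c y}" for a
    using that le assms by (auto simp: order_of_def ole_presented ip_closed)
  fix u assume u: "u \<in> Lower (order_of presented) {c x, c y}"
  then have "u \<in> c ` K" by (auto simp: Lower_def order_of_def carrier_presented)
  then obtain z where z: "z \<in> K" "u = c z" by blast
  have "le z x" "le z y" using u assms z
    by (auto simp: Lower_def order_of_def carrier_presented ole_presented)
  then show "u \<sqsubseteq>\<^bsub>order_of presented\<^esub> c (ip x y)"
    using assms z by (simp add: order_of_def ole_presented ip_closed le_ip_iff)
qed

lemma join_presented: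
  assumes "x \<in> K" "y \<in> K"
  shows "c x \<squnion>\<^bsub>order_of presented\<^esub> c y = c (sp x y)"
  unfolding join_def sup_def
  by (rule some_equality, rule least_sp[OF assms])
    (rule partial_order.least_unique[OF partial_order_presented _ least_sp[OF assms]])

lemma meet_presented:
  assumes "x \<in> K" "y \<in> K"
  shows "c x \<sqinter>\<^bsub>order_of presented\<^esub> c y = c (ip x y)"
  unfolding meet_def inf_def
  by (rule some_equality, rule greatest_ip[OF assms])
    (rule partial_order.greatest_unique[OF partial_order_presented _ greatest_ip[OF assms]])

lemma l_group_presented: "l_group presented"
proof -
  interpret group presented by (rule group_presented)
  interpret O: partial_order "order_of presented" by (rule partial_order_presented)
  have "lattice (order_of presented)"
  proof
    fix a b
    assume "a \<in> carrier (order_of presented)" "b \<in> carrier (order_of presented)"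
    then obtain x y where xy: "x \<in> K" "a = c x" "y \<in> K" "b = c y"
      by (auto simp: carrier_presented order_of_def)
    show "\<exists>s. least (order_of presented) s (Upper (order_of presented) {a, b})"
      using least_sp xy by blast
    show "\<exists>s. greatest (order_of presented) s (Lower (order_of presented) {a, b})"
      using greatest_ip xy by blast
  qed
  then show ?thesis
  proof (intro l_group.intro l_group_axioms.intro group_presented)
    fix a b d
    assume "a \<in> carrier presented" "b \<in> carrier presented" "d \<in> carrier presented"
      and le: "ole presented a b"
    then obtain x y z where *: "x \<in> K" "a = c x" "y \<in> K" "b = c y" "z \<in> K" "d = c z"
      by (auto simp: carrier_presented)
    then show "ole presented (d \<otimes>\<^bsub>presented\<^esub> a) (d \<otimes>\<^bsub>presented\<^esub> b)"
      "ole presented (a \<otimes>\<^bsub>presented\<^esub> d) (b \<otimes>\<^bsub>presented\<^esub> d)"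
      using le by (simp_all add: mult_presented ole_presented mul_closed mono refl)
  qed
qed

text \<open>
  Convexity of \<open>J\<close> for the preorder makes \<open>J\<close> a union of equivalence classes, so conditions on
  representatives suffice.
\<close>

lemma l_ideal_image:
  assumes J: "J \<subseteq> K" "e \<in> J"
    and mul: "\<And>x y. x \<in> J \<Longrightarrow> y \<in> J \<Longrightarrow> mul x y \<in> J"
    and iv: "\<And>x. x \<in> J \<Longrightarrow> iv x \<in> J"
    and conj: "\<And>x y. x \<in> J \<Longrightarrow> y \<in> K \<Longrightarrow> mul (mul y x) (iv y) \<in> J"
    and sp: "\<And>x y. x \<in> J \<Longrightarrow> y \<in> J \<Longrightarrow> sp x y \<in> J"
    and ip: "\<And>x y. x \<in> J \<Longrightarrow> y \<in> J \<Longrightarrow> ip x y \<in> J"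
    and convex: "\<And>x y z. x \<in> J \<Longrightarrow> z \<in> J \<Longrightarrow> y \<in> K \<Longrightarrow> le x y \<Longrightarrow> le y z \<Longrightarrow> y \<in> J"
  shows "l_ideal (c ` J) presented"
proof -
  interpret group presented by (rule group_presented)
  have JK: "x \<in> K" if "x \<in> J" for x using J(1) that by blast
  have sub: "subgroup (c ` J) presented"
  proof
    show "c ` J \<subseteq> carrier presented" using J(1) by (auto simp: carrier_presented)
    show "\<one>\<^bsub>presented\<^esub> \<in> c ` J" using J(2) by (simp add: one_presented)
    show "a \<otimes>\<^bsub>presented\<^esub> b \<in> c ` J" if "a \<in> c ` J" "b \<in> c ` J" for a b
      using that mul JK by (auto simp: mult_presented)
    show "inv\<^bsub>presented\<^esub> a \<in> c ` J" if "a \<in> c ` J" for a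
      using that iv JK by (auto simp: inv_presented)
  qed
  moreover have "a \<otimes>\<^bsub>presented\<^esub> b \<otimes>\<^bsub>presented\<^esub> inv\<^bsub>presented\<^esub> a \<in> c ` J" if "a \<in> carrier presented" "b \<in> c ` J" for a b
    using that conj JK by (auto simp: carrier_presented mult_presented inv_presented mul_closed iv_closed)
  ultimately have "c ` J \<lhd> presented" by (simp add: normal_inv_iff)
  moreover have "l_subgroup (c ` J) presented"
    using sub sp ip JK
    by (intro l_subgroup.intro l_subgroup_axioms.intro) (auto simp: join_presented meet_presented)
  moreover have "b \<in> c ` J" if abd: "a \<in> c ` J" "d \<in> c ` J" "b \<in> carrier presented"
    and le: "ole presented a b" "ole presented b d" for a b d
  proof -
    obtain x y z where *: "x \<in> J" "a = c x" "z \<in> J" "d = c z" "y \<in> K" "b = c y"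
      using abd by (auto simp: carrier_presented)
    then have "le x y" "le y z" using le JK by (simp_all add: ole_presented)
    then have "y \<in> J" by (rule convex[OF *(1,3,5)])
    then show ?thesis unfolding *(6) by (rule imageI)
  qed
  ultimately show ?thesis by (intro l_ideal.intro l_ideal_axioms.intro)
qed

end

section \<open>The direct limit group\<close>

text \<open>
  An element of the direct limit is represented by a sequence of families of automorphisms, one
  family for each level, in which each family is from some level on the lift of the preceding one.
  Two such threads represent the same element if they agree from some level on.
\<close>

type_synonym thread = "nat \<Rightarrow> nat \<Rightarrow> rat \<Rightarrow> rat"

definition encode :: "thread \<Rightarrow> nat set"
  where "encode f = to_nat ` range (\<lambda>(n, v, q). (n, v, q, f n v q))"

lemma inj_encode: "inj encode"
proof (rule injI)
  fix f g :: thread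
  assume "encode f = encode g"
  then have eq: "range (\<lambda>(n, v, q). (n, v, q, f n v q)) = range (\<lambda>(n, v, q). (n, v, q, g n v q))"
    unfolding encode_def by (simp only: inj_image_eq_iff[OF inj_to_nat])
  have "f n v q = g n v q" for n v q
  proof -
    have "(n, v, q, f n v q) \<in> range (\<lambda>(n, v, q). (n, v, q, f n v q))" by (rule range_eqI[of _ _ "(n, v, q)"]) simp
    then show ?thesis unfolding eq by auto
  qed
  then show "f = g" by (intro ext)
qed

definition thread_mul :: "thread \<Rightarrow> thread \<Rightarrow> thread" where "thread_mul f g = (\<lambda>n v. f n v \<circ> g n v)"
definition thread_one :: thread where "thread_one = (\<lambda>n v. id)"
definition thread_inv :: "thread \<Rightarrow> thread" where "thread_inv f = (\<lambda>n v. aut_inv (f n v))"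
definition thread_le :: "thread \<Rightarrow> thread \<Rightarrow> bool" where "thread_le f g \<longleftrightarrow> (\<forall>\<^sub>F n in sequentially. f n \<le> g n)"

definition threads_from :: "(nat \<Rightarrow> nat \<Rightarrow> nat set) \<Rightarrow> nat \<Rightarrow> thread set"
  where "threads_from E m =
    {f. (\<forall>n v. f n v \<in> bounded_auts) \<and> (\<forall>n\<ge>m. f (Suc n) = lift (E n) (f n))}"

definition threads :: "(nat \<Rightarrow> nat \<Rightarrow> nat set) \<Rightarrow> thread set"
  where "threads E = (\<Union>m. threads_from E m)"

lemma threads_from_mono: "m \<le> k \<Longrightarrow> threads_from E m \<subseteq> threads_from E k"
  unfolding threads_from_def by auto

lemma threads_bounded_auts: "f \<in> threads E \<Longrightarrow> f n v \<in> bounded_auts"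
  unfolding threads_def threads_from_def by auto

lemma threads_common_level:
  assumes "f \<in> threads E" "g \<in> threads E"
  obtains m where "f \<in> threads_from E m" "g \<in> threads_from E m"
proof -
  obtain a b where "f \<in> threads_from E a" "g \<in> threads_from E b"
    using assms unfolding threads_def by blast
  then show thesis
    using that[of "max a b"] threads_from_mono[of a "max a b" E] threads_from_mono[of b "max a b" E] by auto
qed

lemma one_threads_from: "thread_one \<in> threads_from E m"
  unfolding threads_from_def thread_one_def using id_bounded_auts by (auto simp: lift_id fun_eq_iff)

lemma mul_threads_from:
  assumes "f \<in> threads_from E m" "g \<in> threads_from E m"
  shows "thread_mul f g \<in> threads_from E m"
  using assms unfolding threads_from_def thread_mul_def
  by (auto simp: comp_bounded_auts lift_comp intro!: ext)

lemma inv_threads_from: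
  assumes "f \<in> threads_from E m"
  shows "thread_inv f \<in> threads_from E m"
  using assms unfolding threads_from_def thread_inv_def
  by (auto simp: inv_bounded_auts lift_inv intro!: ext)

lemma sup_threads_from:
  assumes "f \<in> threads_from E m" "g \<in> threads_from E m"
  shows "sup f g \<in> threads_from E m"
proof -
  have "sup f g (Suc n) = lift (E n) (sup f g n)" if "m \<le> n" for n
  proof
    have "lift (E n) (sup f g n) w = sup (lift (E n) (f n) w) (lift (E n) (g n) w)" for w
      unfolding sup_fun_def[of f g] by (rule lift_sup)
    then show "sup f g (Suc n) w = lift (E n) (sup f g n) w" for w
      using assms that unfolding threads_from_def by simp
  qed
  then show ?thesis using assms unfolding threads_from_def by (simp add: sup_bounded_auts)
qed

lemma inf_threads_from:
  assumes "f \<in> threads_from E m" "g \<in> threads_from E m"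
  shows "inf f g \<in> threads_from E m"
proof -
  have "inf f g (Suc n) = lift (E n) (inf f g n)" if "m \<le> n" for n
  proof
    have "lift (E n) (inf f g n) w = inf (lift (E n) (f n) w) (lift (E n) (g n) w)" for w
      unfolding inf_fun_def[of f g] by (rule lift_inf)
    then show "inf f g (Suc n) w = lift (E n) (inf f g n) w" for w
      using assms that unfolding threads_from_def by simp
  qed
  then show ?thesis using assms unfolding threads_from_def by (simp add: inf_bounded_auts)
qed

lemma threads_closed:
  shows "thread_one \<in> threads E"
    and "f \<in> threads E \<Longrightarrow> thread_inv f \<in> threads E"
    and "f \<in> threads E \<Longrightarrow> g \<in> threads E \<Longrightarrow> thread_mul f g \<in> threads E"
    and "f \<in> threads E \<Longrightarrow> g \<in> threads E \<Longrightarrow> sup f g \<in> threads E"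
    and "f \<in> threads E \<Longrightarrow> g \<in> threads E \<Longrightarrow> inf f g \<in> threads E"
proof -
  show "thread_one \<in> threads E" unfolding threads_def using one_threads_from by blast
  show "f \<in> threads E \<Longrightarrow> thread_inv f \<in> threads E" unfolding threads_def using inv_threads_from by blast
  assume fg: "f \<in> threads E" "g \<in> threads E"
  obtain m where m: "f \<in> threads_from E m" "g \<in> threads_from E m" by (rule threads_common_level[OF fg])
  show "thread_mul f g \<in> threads E" "sup f g \<in> threads E" "inf f g \<in> threads E"
    unfolding threads_def using mul_threads_from[OF m] sup_threads_from[OF m] inf_threads_from[OF m] by blast+
qed

lemma threads_from_le:
  assumes f: "f \<in> threads_from E m" and g: "g \<in> threads_from E m" and "f m \<le> g m"
  shows "thread_le f g"
proof -
  have "f n \<le> g n" if "m \<le> n" for n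
    using that
  proof (induction n rule: dec_induct)
    case (step n)
    then show ?case using f g lift_mono unfolding threads_from_def by simp
  qed fact
  then show ?thesis unfolding thread_le_def eventually_sequentially by blast
qed

text \<open>
  The thread that starts with \<open>h\<close> at level \<open>m\<close>. Below level \<open>m\<close> the identity serves as
  default value.
\<close>

definition extend :: "(nat \<Rightarrow> nat \<Rightarrow> nat set) \<Rightarrow> nat \<Rightarrow> (nat \<Rightarrow> rat \<Rightarrow> rat) \<Rightarrow> thread"
  where "extend E m h n =
    (if n < m then (\<lambda>v. id) else rec_nat h (\<lambda>j. lift (E (m + j))) (n - m))"

lemma extend_base: "extend E m h m = h"
  by (simp add: extend_def)

lemma extend_threads_from:
  assumes "\<And>v. h v \<in> bounded_auts"
  shows "extend E m h \<in> threads_from E m"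
proof -
  have step: "extend E m h (Suc n) = lift (E n) (extend E m h n)" if "m \<le> n" for n
    using that by (simp add: extend_def Suc_diff_le)
  have "extend E m h n v \<in> bounded_auts" for n v
  proof (cases "m \<le> n")
    case True
    then show ?thesis
    proof (induction n arbitrary: v rule: dec_induct)
      case base
      then show ?case by (simp add: extend_base assms)
    next
      case (step n)
      then show ?case using \<open>m \<le> n \<Longrightarrow> extend E m h (Suc n) = lift (E n) (extend E m h n)\<close>
        by (simp add: lift_bounded_auts)
    qed
  next
    case False
    then show ?thesis by (simp add: extend_def id_bounded_auts)
  qed
  then show ?thesis unfolding threads_from_def using step by simp
qed

text \<open>
  A thread consists of countably many rational data, so an equivalence class of threads can be named
  by the set of natural numbers that encodes a chosen member of it.
\<close>

definition germ :: "(nat \<Rightarrow> nat \<Rightarrow> nat set) \<Rightarrow> thread \<Rightarrow> nat set"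
  where "germ E f = encode (SOME g. g \<in> threads E \<and> thread_le f g \<and> thread_le g f)"

lemma thread_le_refl: "thread_le f f"
  by (simp add: thread_le_def)

lemma thread_le_trans: "thread_le f g \<Longrightarrow> thread_le g h \<Longrightarrow> thread_le f h"
  unfolding thread_le_def by (erule (1) eventually_elim2) (rule order_trans)

lemma germ_eq_iff:
  assumes f: "f \<in> threads E" and g: "g \<in> threads E"
  shows "germ E f = germ E g \<longleftrightarrow> thread_le f g \<and> thread_le g f"
proof
  define r where "r f = (SOME g. g \<in> threads E \<and> thread_le f g \<and> thread_le g f)" for f
  have r: "thread_le f (r f)" "thread_le (r f) f" if "f \<in> threads E" for f
    using someI[of "\<lambda>g. g \<in> threads E \<and> thread_le f g \<and> thread_le g f" f] that thread_le_refl unfolding r_def by simp_all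
  assume "germ E f = germ E g"
  then have "r f = r g" unfolding germ_def r_def[symmetric] by (rule injD[OF inj_encode])
  then show "thread_le f g \<and> thread_le g f"
    using thread_le_trans[OF r(1)[OF f], of g] thread_le_trans[OF r(1)[OF g], of f] r(2)[OF f] r(2)[OF g] by simp
next
  assume *: "thread_le f g \<and> thread_le g f"
  have "thread_le f h \<and> thread_le h f \<longleftrightarrow> thread_le g h \<and> thread_le h g" for h
    using thread_le_trans[of f g h] thread_le_trans[of g f h] thread_le_trans[of h f g] thread_le_trans[of h g f] * by auto
  then show "germ E f = germ E g" unfolding germ_def by simp
qed

interpretation limit: l_group_presentation "threads E" thread_mul thread_one thread_inv thread_le sup inf "germ E"
  for E
proof
  fix f g h k :: thread
  show "thread_mul (thread_mul f g) h = thread_mul f (thread_mul g h)" by (simp add: thread_mul_def comp_assoc)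
  show "thread_mul thread_one f = f" by (simp add: thread_mul_def thread_one_def)
  show "thread_le f f" by (rule thread_le_refl)
  show "thread_le f h" if "thread_le f g" "thread_le g h" using that by (rule thread_le_trans)
  assume f: "f \<in> threads E"
  show "thread_mul (thread_inv f) f = thread_one"
    using threads_bounded_auts[OF f] by (simp add: thread_mul_def thread_inv_def thread_one_def fun_eq_iff)
  show "thread_le (sup f g) h \<longleftrightarrow> thread_le f h \<and> thread_le g h" by (simp add: thread_le_def eventually_conj_iff)
  show "thread_le h (inf f g) \<longleftrightarrow> thread_le h f \<and> thread_le h g" by (simp add: thread_le_def eventually_conj_iff)
  assume g: "g \<in> threads E"
  show "germ E f = germ E g \<longleftrightarrow> thread_le f g \<and> thread_le g f" by (rule germ_eq_iff[OF f g])
  assume h: "h \<in> threads E" and k: "k \<in> threads E"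
  show "thread_le (thread_mul f h) (thread_mul g k)" if "thread_le f g" "thread_le h k"
    using that unfolding thread_le_def
  proof (rule eventually_elim2)
    fix n assume *: "f n \<le> g n" "h n \<le> k n"
    have "f n v (h n v q) \<le> g n v (k n v q)" for v q
    proof -
      have "f n v (h n v q) \<le> f n v (k n v q)"
        using *(2) bounded_auts_mono[OF threads_bounded_auts[OF f]] by (simp add: le_fun_def)
      also have "\<dots> \<le> g n v (k n v q)" using *(1) by (simp add: le_fun_def)
      finally show ?thesis .
    qed
    then show "thread_mul f h n \<le> thread_mul g k n" by (simp add: thread_mul_def le_fun_def)
  qed
qed (simp_all add: threads_closed)

section \<open>The ideals of the limit group\<close>

text \<open>
  The sequence of labelled atoms constructed above, with its three essential properties. The second
  one makes the labels determine, in the limit, the order between sets of atoms.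
\<close>

locale refinement_diagram = distributive_semilattice_zero L
  for L :: "('a, 'b) gorder_scheme" (structure) +
  fixes V :: "nat \<Rightarrow> nat set" and \<phi> :: "nat \<Rightarrow> nat \<Rightarrow> 'a" and E :: "nat \<Rightarrow> nat \<Rightarrow> nat set"
  assumes level_refines: "refines L (V n) (\<phi> n) (E n) (V (Suc n)) (\<phi> (Suc n))"
    and absorb: "A \<subseteq> V n \<Longrightarrow> B \<subseteq> V n \<Longrightarrow> dominated L (\<phi> n) A B \<Longrightarrow>
      (\<Union>v\<in>A. E n v) \<subseteq> (\<Union>v\<in>B. E n v)"
    and exhaust: "s \<in> carrier L \<Longrightarrow> \<exists>n. s \<in> \<phi> (Suc n) ` V (Suc n)"
begin

abbreviation "K \<equiv> threads E"
abbreviation "H \<equiv> limit.presented E"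

text \<open>
  The threads whose value, the join of the labels of the support at late levels, is at most \<open>s\<close>.
\<close>

definition below :: "'a \<Rightarrow> thread set"
  where "below s = {f \<in> K. \<forall>\<^sub>F n in sequentially. \<forall>v\<in>supp (f n). \<phi> n v \<sqsubseteq> s}"

lemma supp_Suc: "f \<in> threads_from E m \<Longrightarrow> m \<le> n \<Longrightarrow> supp (f (Suc n)) = (\<Union>v\<in>supp (f n). E n v)"
  unfolding threads_from_def by (simp add: supp_lift)

text \<open>
  Families are indexed by all natural numbers, not just by the atoms of a level. No harm is done: the
  lift along \<open>E n\<close> is the identity in every coordinate that is not an atom of level \<open>Suc n\<close>, since such
  a coordinate has no parent.
\<close>

lemma supp_Suc_subset:
  assumes "f \<in> threads_from E m" "m \<le> n"
  shows "supp (f (Suc n)) \<subseteq> V (Suc n)"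
proof -
  have "E n v \<subseteq> V (Suc n)" for v using level_refines[of n] unfolding refines_def by simp
  then show ?thesis unfolding supp_Suc[OF assms] by (rule UN_least)
qed

lemma threads_supp_level:
  assumes "f \<in> K" "g \<in> K"
  obtains m where "f \<in> threads_from E m" "g \<in> threads_from E m" "supp (f m) \<subseteq> V m" "supp (g m) \<subseteq> V m"
proof -
  obtain m where m: "f \<in> threads_from E m" "g \<in> threads_from E m"
    by (rule threads_common_level[OF assms])
  show thesis
  proof (rule that)
    show "f \<in> threads_from E (Suc m)" "g \<in> threads_from E (Suc m)"
      using m threads_from_mono[of m "Suc m" E] by auto
    show "supp (f (Suc m)) \<subseteq> V (Suc m)" "supp (g (Suc m)) \<subseteq> V (Suc m)"
      by (rule supp_Suc_subset[OF m(1) order.refl], rule supp_Suc_subset[OF m(2) order.refl])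
  qed
qed

text \<open>
  Since a label is the join of the labels of its children, the value can be read off at any level
  from which on the thread is coherent and supported by the atoms.
\<close>

lemma mem_below_iff:
  assumes f: "f \<in> threads_from E m" and "supp (f m) \<subseteq> V m" and t: "t \<in> carrier L"
  shows "f \<in> below t \<longleftrightarrow> (\<forall>v\<in>supp (f m). \<phi> m v \<sqsubseteq> t)"
proof -
  have inv: "supp (f n) \<subseteq> V n \<and> ((\<forall>v\<in>supp (f n). \<phi> n v \<sqsubseteq> t) \<longleftrightarrow> (\<forall>v\<in>supp (f m). \<phi> m v \<sqsubseteq> t))"
    if "m \<le> n" for n
    using that
  proof (induction n rule: dec_induct)
    case base
    then show ?case using assms(2) by simp
  next
    case (step n)
    have "\<phi> n v \<sqsubseteq> t \<longleftrightarrow> (\<forall>w\<in>E n v. \<phi> (Suc n) w \<sqsubseteq> t)" if "v \<in> supp (f n)" for v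
    proof -
      have "v \<in> V n" using step.IH that by blast
      then show ?thesis using level_refines[of n] t unfolding refines_def by simp
    qed
    then have "(\<forall>v\<in>supp (f n). \<phi> n v \<sqsubseteq> t) \<longleftrightarrow> (\<forall>w\<in>supp (f (Suc n)). \<phi> (Suc n) w \<sqsubseteq> t)"
      unfolding supp_Suc[OF f step.hyps(1)] by simp
    then show ?case using step.IH supp_Suc_subset[OF f step.hyps(1)] by simp
  qed
  have "(\<forall>\<^sub>F n in sequentially. \<forall>v\<in>supp (f n). \<phi> n v \<sqsubseteq> t) \<longleftrightarrow>
      (\<forall>\<^sub>F n in sequentially. \<forall>v\<in>supp (f m). \<phi> m v \<sqsubseteq> t)"
    by (rule eventually_cong[OF eventually_ge_at_top[of m]]) (rule inv[THEN conjunct2])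
  then show ?thesis using f unfolding below_def threads_def by auto
qed

lemma value_exists:
  assumes "f \<in> K"
  shows "\<exists>s\<in>carrier L. \<forall>t\<in>carrier L. f \<in> below t \<longleftrightarrow> s \<sqsubseteq> t"
proof -
  obtain k where k: "f \<in> threads_from E k" using assms unfolding threads_def by blast
  have "finite (V (Suc k))" "\<phi> (Suc k) ` V (Suc k) \<subseteq> carrier L"
    using level_refines[of k] unfolding refines_def by simp_all
  moreover have sub: "supp (f (Suc k)) \<subseteq> V (Suc k)" by (rule supp_Suc_subset[OF k order.refl])
  ultimately have "finite (supp (f (Suc k)))" "\<phi> (Suc k) ` supp (f (Suc k)) \<subseteq> carrier L"
    using finite_subset by blast+
  then obtain s where s: "s \<in> carrier L"
    "\<And>t. t \<in> carrier L \<Longrightarrow> s \<sqsubseteq> t \<longleftrightarrow> (\<forall>v\<in>supp (f (Suc k)). \<phi> (Suc k) v \<sqsubseteq> t)"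
    by (rule finite_least_upper_bound) blast
  have f: "f \<in> threads_from E (Suc k)" using k threads_from_mono[of k "Suc k" E] by auto
  show ?thesis using s mem_below_iff[OF f sub] by (intro bexI[of _ s]) simp_all
qed

lemma value_attained:
  assumes "s \<in> carrier L"
  shows "\<exists>f\<in>K. \<forall>t\<in>carrier L. f \<in> below t \<longleftrightarrow> s \<sqsubseteq> t"
proof -
  obtain n v where v: "v \<in> V (Suc n)" "s = \<phi> (Suc n) v" using exhaust[OF assms] by blast
  define h where "h = (\<lambda>u::nat. if u = v then bump 0 1 2 3 else id)"
  have "bump 0 1 2 3 1 \<noteq> 1" by (simp add: bump_apply)
  then have "supp h = {v}" unfolding supp_def h_def by (auto simp: fun_eq_iff)
  moreover have "h u \<in> bounded_auts" for u
    unfolding h_def using id_bounded_auts bump_bounded_auts[of 0 1 3 2] by simp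
  from extend_threads_from[of h, OF this] have f: "extend E (Suc n) h \<in> threads_from E (Suc n)" .
  ultimately have "extend E (Suc n) h \<in> below t \<longleftrightarrow> s \<sqsubseteq> t" if "t \<in> carrier L" for t
    using mem_below_iff[OF f _ that] v by (simp add: extend_base)
  moreover have "extend E (Suc n) h \<in> K" using f unfolding threads_def by blast
  ultimately show ?thesis by (intro bexI[of _ "extend E (Suc n) h"]) simp_all
qed

lemma below_convex:
  assumes x: "x \<in> below s" and z: "z \<in> below s" and y: "y \<in> K" and le: "thread_le x y" "thread_le y z"
  shows "y \<in> below s"
proof -
  have "\<forall>\<^sub>F n in sequentially. (x n \<le> y n \<and> y n \<le> z n) \<and>
      (\<forall>v\<in>supp (x n). \<phi> n v \<sqsubseteq> s) \<and> (\<forall>v\<in>supp (z n). \<phi> n v \<sqsubseteq> s)"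
    using x z le unfolding below_def thread_le_def by (simp add: eventually_conj_iff)
  then have "\<forall>\<^sub>F n in sequentially. \<forall>v\<in>supp (y n). \<phi> n v \<sqsubseteq> s"
  proof (rule eventually_mono, intro ballI)
    fix n v
    assume *: "(x n \<le> y n \<and> y n \<le> z n) \<and>
      (\<forall>v\<in>supp (x n). \<phi> n v \<sqsubseteq> s) \<and> (\<forall>v\<in>supp (z n). \<phi> n v \<sqsubseteq> s)"
      and v: "v \<in> supp (y n)"
    have "x n v \<noteq> id \<or> z n v \<noteq> id"
    proof (rule ccontr)
      assume "\<not> ?thesis"
      then have "y n v = id" using * by (metis antisym le_funD)
      then show False using v by (simp add: supp_def)
    qed
    then show "\<phi> n v \<sqsubseteq> s" using * by (auto simp: supp_def)
  qed
  then show "y \<in> below s" using y unfolding below_def by simp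
qed

text \<open>
  Each operation, conjugation included, yields the identity in every coordinate in which its arguments
  from \<open>below s\<close> are the identity.
\<close>

lemma l_ideal_below:
  assumes "s \<in> carrier L"
  shows "l_ideal (germ E ` below s) H"
proof -
  have mem: "f \<in> below s" if "f \<in> K" "\<And>n v. \<forall>v. (v \<in> supp (f n)) \<longrightarrow> v \<in> supp (g n) \<union> supp (h n)"
    "g \<in> below s" "h \<in> below s" for f g h
  proof -
    have "\<forall>\<^sub>F n in sequentially. \<forall>v\<in>supp (g n). \<phi> n v \<sqsubseteq> s"
      "\<forall>\<^sub>F n in sequentially. \<forall>v\<in>supp (h n). \<phi> n v \<sqsubseteq> s"
      using that(3,4) unfolding below_def by simp_all
    then have "\<forall>\<^sub>F n in sequentially. \<forall>v\<in>supp (f n). \<phi> n v \<sqsubseteq> s"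
      by (rule eventually_elim2) (use that(2) in blast)
    then show ?thesis using that(1) unfolding below_def by simp
  qed
  have K: "f \<in> K" if "f \<in> below s" for f using that unfolding below_def by simp
  show ?thesis
  proof (rule limit.l_ideal_image)
    show "below s \<subseteq> K" using K by blast
    have "supp (thread_one n) = {}" for n by (simp add: supp_def thread_one_def)
    then show "thread_one \<in> below s" unfolding below_def by (simp add: threads_closed(1))
  next
    fix x y assume xy: "x \<in> below s" "y \<in> below s"
    note xyK = xy[THEN K]
    show "thread_mul x y \<in> below s"
      by (rule mem[OF threads_closed(3)[OF xyK] _ xy]) (auto simp: supp_def thread_mul_def)
    show "sup x y \<in> below s"
      by (rule mem[OF threads_closed(4)[OF xyK] _ xy]) (auto simp: supp_def)
    show "inf x y \<in> below s"
      by (rule mem[OF threads_closed(5)[OF xyK] _ xy]) (auto simp: supp_def)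
  next
    fix x assume x: "x \<in> below s"
    show "thread_inv x \<in> below s"
      by (rule mem[OF threads_closed(2)[OF K[OF x]] _ x x]) (auto simp: supp_def thread_inv_def)
    show "thread_mul (thread_mul y x) (thread_inv y) \<in> below s" if y: "y \<in> K" for y
    proof (rule mem[OF _ _ x x])
      show "thread_mul (thread_mul y x) (thread_inv y) \<in> K" using y K[OF x] by (simp add: threads_closed)
      have "y n v \<circ> aut_inv (y n v) = id" for n v
        using threads_bounded_auts[OF y] by (simp add: fun_eq_iff)
      then show "\<forall>v. v \<in> supp (thread_mul (thread_mul y x) (thread_inv y) n) \<longrightarrow> v \<in> supp (x n) \<union> supp (x n)" for n
        by (auto simp: supp_def thread_inv_def thread_mul_def)
    qed
  next
    show "y \<in> below s" if "x \<in> below s" "z \<in> below s" "y \<in> K" "thread_le x y" "thread_le y z" for x y z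
      using that by (rule below_convex)
  qed
qed

text \<open>
  The assumption says that at some level the join of the labels of the support of \<open>f\<close> lies below that
  of \<open>g\<close>. One level later the supports themselves are nested, and \<open>\<bar>g\<bar>\<close> can be conjugated above \<open>\<bar>f\<bar>\<close>
  in each coordinate separately. The inequality found at this level persists, because lifting is
  monotone.
\<close>

lemma dominated_by_conjugate:
  assumes f: "f \<in> K" and g: "g \<in> K"
    and dom: "\<And>t. t \<in> carrier L \<Longrightarrow> g \<in> below t \<Longrightarrow> f \<in> below t"
  obtains h where "h \<in> K" "thread_le f (thread_mul (thread_mul h (sup g (thread_inv g))) (thread_inv h))"
    "thread_le (thread_inv f) (thread_mul (thread_mul h (sup g (thread_inv g))) (thread_inv h))"
proof -
  obtain k where k: "f \<in> threads_from E k" "g \<in> threads_from E k" "supp (f k) \<subseteq> V k" "supp (g k) \<subseteq> V k"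
    by (rule threads_supp_level[OF f g])
  have "dominated L (\<phi> k) (supp (f k)) (supp (g k))"
    unfolding dominated_def
    using dom mem_below_iff[OF k(1,3)] mem_below_iff[OF k(2,4)] by simp
  from absorb[OF k(3,4) this] have sub: "supp (f (Suc k)) \<subseteq> supp (g (Suc k))"
    unfolding supp_Suc[OF k(1) order.refl] supp_Suc[OF k(2) order.refl] .
  define m where "m = Suc k"
  have fg: "f \<in> threads_from E m" "g \<in> threads_from E m"
    using k(1,2) threads_from_mono[of k m E] unfolding m_def by auto
  have "\<exists>h. h \<in> bounded_auts \<and> f m v \<le> h \<circ> sup (g m v) (aut_inv (g m v)) \<circ> aut_inv h \<and>
      aut_inv (f m v) \<le> h \<circ> sup (g m v) (aut_inv (g m v)) \<circ> aut_inv h" for v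
  proof (cases "g m v = id")
    case True
    then have "f m v = id" using sub unfolding m_def supp_def by blast
    then show ?thesis using True id_bounded_auts by (intro exI[of _ id]) (simp add: inv_id)
  next
    case False
    obtain h where "h \<in> bounded_auts" "f m v \<le> h \<circ> sup (g m v) (aut_inv (g m v)) \<circ> aut_inv h"
      "aut_inv (f m v) \<le> h \<circ> sup (g m v) (aut_inv (g m v)) \<circ> aut_inv h"
      by (rule conjugate_dominates[OF threads_bounded_auts[OF f] threads_bounded_auts[OF g] False])
    then show ?thesis by (intro exI conjI)
  qed
  then have "\<exists>h. \<forall>v. h v \<in> bounded_auts \<and> f m v \<le> h v \<circ> sup (g m v) (aut_inv (g m v)) \<circ> aut_inv (h v) \<and>
      aut_inv (f m v) \<le> h v \<circ> sup (g m v) (aut_inv (g m v)) \<circ> aut_inv (h v)"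
    by (intro choice allI)
  then obtain h0 where h0: "\<forall>v. h0 v \<in> bounded_auts \<and>
      f m v \<le> h0 v \<circ> sup (g m v) (aut_inv (g m v)) \<circ> aut_inv (h0 v) \<and>
      aut_inv (f m v) \<le> h0 v \<circ> sup (g m v) (aut_inv (g m v)) \<circ> aut_inv (h0 v)" by (elim exE)
  define h where "h = extend E m h0"
  have h: "h \<in> threads_from E m" unfolding h_def using h0 by (intro extend_threads_from) simp
  have hm: "h m = h0" unfolding h_def by (rule extend_base)
  have conj: "thread_mul (thread_mul h (sup g (thread_inv g))) (thread_inv h) \<in> threads_from E m"
    by (intro mul_threads_from sup_threads_from inv_threads_from h fg)
  have "f m \<le> thread_mul (thread_mul h (sup g (thread_inv g))) (thread_inv h) m" "thread_inv f m \<le> thread_mul (thread_mul h (sup g (thread_inv g))) (thread_inv h) m"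
    using h0 by (simp_all add: thread_mul_def thread_inv_def hm le_fun_def[of "f m"] le_fun_def[of "\<lambda>v. aut_inv (f m v)"])
  then have "thread_le f (thread_mul (thread_mul h (sup g (thread_inv g))) (thread_inv h))" "thread_le (thread_inv f) (thread_mul (thread_mul h (sup g (thread_inv g))) (thread_inv h))"
    using threads_from_le[OF fg(1) conj] threads_from_le[OF inv_threads_from[OF fg(1)] conj] by simp_all
  moreover have "h \<in> K" using h unfolding threads_def by blast
  ultimately show thesis using that by simp
qed

lemma mem_l_ideal_generated:
  assumes f: "f \<in> K" and g: "g \<in> K"
    and dom: "\<And>t. t \<in> carrier L \<Longrightarrow> g \<in> below t \<Longrightarrow> f \<in> below t"
  shows "germ E f \<in> l_ideal_generated H {germ E g}"
proof -
  interpret G: l_group H by (rule limit.l_group_presented)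
  have gH: "{germ E g} \<subseteq> carrier H" using g by (simp add: limit.carrier_presented)
  interpret J: l_ideal "l_ideal_generated H {germ E g}" H
    by (rule G.l_ideal_l_ideal_generated[OF gH])
  obtain h where h: "h \<in> K" and le: "thread_le f (thread_mul (thread_mul h (sup g (thread_inv g))) (thread_inv h))"
    "thread_le (thread_inv f) (thread_mul (thread_mul h (sup g (thread_inv g))) (thread_inv h))"
    by (rule dominated_by_conjugate[OF f g dom])
  define y where "y = thread_mul (thread_mul h (sup g (thread_inv g))) (thread_inv h)"
  have y: "y \<in> K" unfolding y_def using g h by (simp add: threads_closed)
  have gJ: "germ E g \<in> l_ideal_generated H {germ E g}" using G.generators_subset[of "{germ E g}"] by simp
  then have "germ E (thread_inv g) \<in> l_ideal_generated H {germ E g}"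
    using J.m_inv_closed limit.inv_presented[OF g] by metis
  then have "germ E (sup g (thread_inv g)) \<in> l_ideal_generated H {germ E g}"
    using J.join_mem[OF gJ] limit.join_presented[OF g threads_closed(2)[OF g]] by metis
  moreover have hH: "germ E h \<in> carrier H" using h by (simp add: limit.carrier_presented)
  ultimately have "germ E h \<otimes>\<^bsub>H\<^esub> germ E (sup g (thread_inv g)) \<otimes>\<^bsub>H\<^esub> inv\<^bsub>H\<^esub> germ E h \<in> l_ideal_generated H {germ E g}"
    by (intro J.inv_op_closed2)
  then have yJ: "germ E y \<in> l_ideal_generated H {germ E g}"
    unfolding y_def using g h by (simp add: limit.inv_presented limit.mult_presented threads_closed)
  have ivyJ: "germ E (thread_inv y) \<in> l_ideal_generated H {germ E g}"
    using J.m_inv_closed[OF yJ] limit.inv_presented[OF y] by simp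
  have "thread_le (thread_inv y) f"
    using le(2) unfolding y_def[symmetric] thread_le_def
  proof (rule eventually_mono)
    fix n assume *: "thread_inv f n \<le> y n"
    show "thread_inv y n \<le> f n"
    proof (rule le_funI)
      show "thread_inv y n v \<le> f n v" for v
        unfolding thread_inv_def
        by (rule inv_le_swap[OF threads_bounded_auts[OF f] threads_bounded_auts[OF y] le_funD[OF *[unfolded thread_inv_def]]])
    qed
  qed
  then show ?thesis
    using J.convex[OF ivyJ yJ, of "germ E f"] le(1) f y
    by (simp add: limit.carrier_presented limit.ole_presented threads_closed y_def[symmetric])
qed

text \<open>
  The join \<open>\<bar>f\<bar> \<squnion> \<bar>g\<bar>\<close> works: where it is the identity, so are \<open>f\<close> and \<open>g\<close>.
\<close>

lemma bounded_by_common_thread: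
  assumes f: "f \<in> K" and g: "g \<in> K"
  shows "\<exists>h\<in>K. germ E h \<in> l_ideal_generated H {germ E f, germ E g} \<and>
    (\<forall>t. h \<in> below t \<longrightarrow> f \<in> below t \<and> g \<in> below t)"
proof -
  interpret G: l_group H by (rule limit.l_group_presented)
  have fgH: "{germ E f, germ E g} \<subseteq> carrier H" using f g by (simp add: limit.carrier_presented)
  interpret J: l_ideal "l_ideal_generated H {germ E f, germ E g}" H
    by (rule G.l_ideal_l_ideal_generated[OF fgH])
  define h where "h = sup (sup f (thread_inv f)) (sup g (thread_inv g))"
  have hK: "h \<in> K" unfolding h_def using f g by (simp add: threads_closed)
  have abs: "germ E (sup x (thread_inv x)) \<in> l_ideal_generated H {germ E f, germ E g}"
    if x: "x \<in> K" "germ E x \<in> l_ideal_generated H {germ E f, germ E g}" for x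
    using J.join_mem[OF x(2) J.m_inv_closed[OF x(2)]] x(1)
    by (simp add: limit.inv_presented limit.join_presented threads_closed)
  have "germ E f \<in> l_ideal_generated H {germ E f, germ E g}"
    "germ E g \<in> l_ideal_generated H {germ E f, germ E g}"
    using G.generators_subset[of "{germ E f, germ E g}"] by simp_all
  from J.join_mem[OF abs[OF f this(1)] abs[OF g this(2)]]
  have "germ E h \<in> l_ideal_generated H {germ E f, germ E g}"
    unfolding h_def using f g by (simp add: limit.join_presented threads_closed)
  moreover have "x \<in> below t" if x: "x \<in> K" "x \<le> h" "thread_inv x \<le> h" and "h \<in> below t" for x t
  proof -
    have "supp (x n) \<subseteq> supp (h n)" for n
    proof
      fix v assume v: "v \<in> supp (x n)"
      show "v \<in> supp (h n)"
      proof (rule ccontr)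
        assume "v \<notin> supp (h n)"
        then have "h n v = id" by (simp add: supp_def)
        moreover have "x n v \<le> h n v" "aut_inv (x n v) \<le> h n v"
          using x(2,3) by (simp_all add: le_fun_def thread_inv_def)
        ultimately have "x n v = id"
          using eq_id_if_le_id[OF threads_bounded_auts[OF x(1)]] by simp
        then show False using v by (simp add: supp_def)
      qed
    qed
    moreover have "\<forall>\<^sub>F n in sequentially. \<forall>v\<in>supp (h n). \<phi> n v \<sqsubseteq> t"
      using \<open>h \<in> below t\<close> unfolding below_def by simp
    ultimately have "\<forall>\<^sub>F n in sequentially. \<forall>v\<in>supp (x n). \<phi> n v \<sqsubseteq> t"
      by (elim eventually_mono) blast
    then show ?thesis using x(1) unfolding below_def by simp
  qed
  moreover have "f \<le> h" "thread_inv f \<le> h" "g \<le> h" "thread_inv g \<le> h"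
    unfolding h_def by (simp_all add: le_supI1 le_supI2)
  ultimately show ?thesis using hK f g by (intro bexI[of _ h] conjI allI impI) simp_all
qed

lemma semilattice_zero_iso_limit: "semilattice_zero_iso L (fg_l_ideals H) \<noteq> {}"
proof -
  interpret G: l_group H by (rule limit.l_group_presented)
  define val where "val f = (SOME s. s \<in> carrier L \<and> (\<forall>t\<in>carrier L. f \<in> below t \<longleftrightarrow> s \<sqsubseteq> t))" for f
  have vl: "val f \<in> carrier L" "\<And>t. t \<in> carrier L \<Longrightarrow> f \<in> below t \<longleftrightarrow> val f \<sqsubseteq> t" if f: "f \<in> K" for f
    using someI_ex[OF value_exists[OF f, unfolded Bex_def]] unfolding val_def[symmetric] by simp_all
  define \<nu> where "\<nu> a = val (limit.rep E a)" for a
  have \<nu>_closed: "\<nu> (germ E f) \<in> carrier L" if "f \<in> K" for f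
    unfolding \<nu>_def by (rule vl(1)[OF limit.rep(1)[OF that]])
  have \<nu>: "\<nu> (germ E f) \<sqsubseteq> t \<longleftrightarrow> f \<in> below t" if f: "f \<in> K" and t: "t \<in> carrier L" for f t
  proof -
    note r = limit.rep[OF f]
    have "\<nu> (germ E f) \<sqsubseteq> t \<longleftrightarrow> limit.rep E (germ E f) \<in> below t"
      unfolding \<nu>_def by (rule vl(2)[OF r(1) t, symmetric])
    also have "\<dots> \<longleftrightarrow> f \<in> below t"
    proof
      show "f \<in> below t" if "limit.rep E (germ E f) \<in> below t"
        by (rule below_convex[OF that that f r(2,3)])
      show "limit.rep E (germ E f) \<in> below t" if "f \<in> below t"
        by (rule below_convex[OF that that r(1,3,2)])
    qed
    finally show ?thesis .
  qed
  have "(\<lambda>s. {a \<in> carrier H. \<nu> a \<sqsubseteq> s}) \<in> semilattice_zero_iso L (fg_l_ideals H)"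
  proof (rule G.semilattice_zero_iso_fg_l_ideals)
    show "semilattice_zero L" by unfold_locales
  next
    fix s assume s: "s \<in> carrier L"
    have "{a \<in> carrier H. \<nu> a \<sqsubseteq> s} = {germ E f |f. f \<in> K \<and> f \<in> below s}"
      using \<nu>[OF _ s] by (auto simp: limit.carrier_presented)
    also have "\<dots> = germ E ` below s" unfolding below_def by auto
    finally show "l_ideal {a \<in> carrier H. \<nu> a \<sqsubseteq> s} H" using l_ideal_below[OF s] by simp
  next
    show "\<nu> ` carrier H = carrier L"
    proof (intro equalityI subsetI)
      fix s assume "s \<in> \<nu> ` carrier H"
      then show "s \<in> carrier L" using \<nu>_closed by (auto simp: limit.carrier_presented)
    next
      fix s assume s: "s \<in> carrier L"
      obtain f where f: "f \<in> K" "\<forall>t\<in>carrier L. f \<in> below t \<longleftrightarrow> s \<sqsubseteq> t"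
        using value_attained[OF s] by (elim bexE)
      have c: "\<nu> (germ E f) \<in> carrier L" by (rule \<nu>_closed[OF f(1)])
      have "s \<sqsubseteq> \<nu> (germ E f)" using \<nu>[OF f(1) c] f(2) c by simp
      moreover have "\<nu> (germ E f) \<sqsubseteq> s" using \<nu>[OF f(1) s] f(2) s by simp
      ultimately have "s = \<nu> (germ E f)" using s c by (intro le_antisym)
      moreover have "germ E f \<in> carrier H" using f(1) by (simp add: limit.carrier_presented)
      ultimately show "s \<in> \<nu> ` carrier H" by (rule image_eqI)
    qed
  next
    fix a b assume "a \<in> carrier H" "b \<in> carrier H"
    then obtain f g where f: "f \<in> K" "a = germ E f" and g: "g \<in> K" "b = germ E g"
      by (auto simp: limit.carrier_presented)
    note c = \<nu>_closed[OF f(1)] \<nu>_closed[OF g(1)]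
    show "a \<in> l_ideal_generated H {b}" if le: "\<nu> a \<sqsubseteq> \<nu> b"
      unfolding f(2) g(2)
    proof (rule mem_l_ideal_generated[OF f(1) g(1)])
      fix t assume t: "t \<in> carrier L" and "g \<in> below t"
      then have "\<nu> b \<sqsubseteq> t" unfolding g(2) using \<nu>[OF g(1)] by simp
      then have "\<nu> a \<sqsubseteq> t" using le_trans[OF le] c t unfolding f(2) g(2) by simp
      then show "f \<in> below t" unfolding f(2) using \<nu>[OF f(1) t] by simp
    qed
    obtain h where h: "h \<in> K" "germ E h \<in> l_ideal_generated H {a, b}"
      "\<forall>t. h \<in> below t \<longrightarrow> f \<in> below t \<and> g \<in> below t"
      using bounded_by_common_thread[OF f(1) g(1)] unfolding f(2) g(2) by (elim bexE conjE)
    have ch: "\<nu> (germ E h) \<in> carrier L" by (rule \<nu>_closed[OF h(1)])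
    then have "h \<in> below (\<nu> (germ E h))" using \<nu>[OF h(1) ch] by simp
    then have "\<nu> a \<sqsubseteq> \<nu> (germ E h)" "\<nu> b \<sqsubseteq> \<nu> (germ E h)"
      unfolding f(2) g(2) using h(3) \<nu>[OF f(1) ch] \<nu>[OF g(1) ch] by simp_all
    then show "\<exists>k \<in> l_ideal_generated H {a, b}. \<nu> a \<sqsubseteq> \<nu> k \<and> \<nu> b \<sqsubseteq> \<nu> k"
      using h(2) by (intro bexI conjI)
  qed
  then show ?thesis by blast
qed

end

theorem theorem6p3:
  fixes S :: "('a, 'b) gorder_scheme"
  assumes "distributive_semilattice_zero S"
    and "countable (carrier S)"
  shows "\<exists>G :: nat set ordered_monoid.
    l_group G \<and> semilattice_zero_iso S (fg_l_ideals G) \<noteq> {}"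
proof -
  interpret distributive_semilattice_zero S by (rule assms(1))
  obtain V \<phi> E where "refinement_diagram S V \<phi> E"
  proof (rule refinement_diagram_exists[OF assms(2)])
    fix V \<phi> E
    assume "\<And>n. refines S (V n) (\<phi> n) (E n) (V (Suc n)) (\<phi> (Suc n))"
      "\<And>n A B. A \<subseteq> V n \<Longrightarrow> B \<subseteq> V n \<Longrightarrow> dominated S (\<phi> n) A B \<Longrightarrow>
        (\<Union>v\<in>A. E n v) \<subseteq> (\<Union>v\<in>B. E n v)"
      "\<And>s. s \<in> carrier S \<Longrightarrow> \<exists>n. s \<in> \<phi> (Suc n) ` V (Suc n)"
    then have "refinement_diagram S V \<phi> E" by unfold_locales
    then show thesis by (rule that)
  qed
  then interpret refinement_diagram S V \<phi> E .
  show ?thesis using limit.l_group_presented[of E] semilattice_zero_iso_limit by (intro exI conjI)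
qed

end
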